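(* Let $0<\alpha<\delta$ be real numbers and let $(X(t),Y(t))^\top$, $t\ge0$, be the continuum Pólya-like random walk in two dimensions with the balanced triangular navigation matrix $$\mathbf{A}=\begin{pmatrix}\alpha&\delta-\alpha\\0&\delta\end{pmatrix}$$ and starting position $(X(0),Y(0))^\top$, where $X(0),Y(0)\ge 0$ are not both zero. Then, for every $t\ge0$, the joint moment generating function is $$\mathbb{E}\bigl[e^{uX(t)+vY(t)}\bigr]=e^{-X(0)\,t}\Bigl(e^{-\alpha u}-e^{-\alpha v}+\bigl(e^{-\delta v}-1+e^{-\delta t}\bigr)^{\alpha/\delta}\Bigr)^{-X(0)/\alpha}\times e^{-Y(0)\,t}\bigl(e^{-\delta v}-1+e^{-\delta t}\bigr)^{-Y(0)/\delta}$$ for all $(u,v)$ in a neighborhood (possibly depending on $t$) of $(0,0)$.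
   Context: Continuum Pólya-like random walk in two dimensions with navigation matrix $\mathbf{A}=(A_{i,j})_{1\le i,j\le 2}$: the process $(X_1(t),X_2(t))^\top=(X(t),Y(t))^\top$, with deterministic starting position, is the continuous-time pure jump process with the following dynamics. At any time $t$, given the current position, the next renewal (jump) occurs after an exponentially distributed waiting time with mean $1/(X_1(t)+X_2(t))$. Given that a renewal occurs, it is of type $i\in\{1,2\}$ with probability $X_i(t)/(X_1(t)+X_2(t))$ (position just before the jump). At a renewal of type $i$, the amount $A_{i,j}$ is added to the $j$th coordinate, for $j=1,2$. Tenability (standing assumption): the walk always avoids the origin and every coordinate always stays nonnegative; for the matrix here this amounts to the stated condition on $(X(0),Y(0))$. *)

theory Defs
  imports "HOL-Probability.Probability"
begin

text \<open>
  The walk is described by its waiting times \<open>W\<close> and its renewal types \<open>I\<close>: \<open>W n\<close> is the time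
  between the \<open>n\<close>-th and the \<open>(n+1)\<close>-st renewal, and \<open>I n\<close> is the type of the \<open>(n+1)\<close>-st renewal.
  The index type \<open>2\<close> has the two elements \<open>1\<close> and \<open>2\<close>; row \<open>i\<close> of the navigation matrix is \<open>A $ i\<close>.
\<close>

definition renewal_time :: "(nat \<Rightarrow> 'a \<Rightarrow> real) \<Rightarrow> nat \<Rightarrow> 'a \<Rightarrow> real" where
  "renewal_time W n \<omega> = (\<Sum>k<n. W k \<omega>)"

definition renewal_position ::
  "real^2^2 \<Rightarrow> real^2 \<Rightarrow> (nat \<Rightarrow> 'a \<Rightarrow> 2) \<Rightarrow> nat \<Rightarrow> 'a \<Rightarrow> real^2" where
  "renewal_position A x\<^sub>0 I n \<omega> = x\<^sub>0 + (\<Sum>k<n. A $ I k \<omega>)"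

text \<open>
  The sigma-algebra generated by the first \<open>n\<close> waiting times and types, and the one generated by
  these together with the waiting time for the next renewal.
\<close>

definition history ::
  "'a measure \<Rightarrow> (nat \<Rightarrow> 'a \<Rightarrow> real) \<Rightarrow> (nat \<Rightarrow> 'a \<Rightarrow> 2) \<Rightarrow> nat \<Rightarrow> 'a measure" where
  "history M W I n =
     vimage_algebra (space M) (\<lambda>\<omega>. \<lambda>k\<in>{..<n}. (W k \<omega>, I k \<omega>))
       (Pi\<^sub>M {..<n} (\<lambda>_. borel \<Otimes>\<^sub>M count_space UNIV))"

definition history_wait ::
  "'a measure \<Rightarrow> (nat \<Rightarrow> 'a \<Rightarrow> real) \<Rightarrow> (nat \<Rightarrow> 'a \<Rightarrow> 2) \<Rightarrow> nat \<Rightarrow> 'a measure" where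
  "history_wait M W I n =
     vimage_algebra (space M) (\<lambda>\<omega>. (\<lambda>k\<in>{..<n}. (W k \<omega>, I k \<omega>), W n \<omega>))
       (Pi\<^sub>M {..<n} (\<lambda>_. borel \<Otimes>\<^sub>M count_space UNIV) \<Otimes>\<^sub>M borel)"

text \<open>
  Conditionally on the past, the waiting time is exponential with rate \<open>Z $ 1 + Z $ 2\<close>, where \<open>Z\<close> is
  the current position; conditionally on the past and the waiting time, the renewal is of type \<open>i\<close>
  with probability \<open>Z $ i / (Z $ 1 + Z $ 2)\<close>.  The two conditional laws are meaningful only for
  tenable \<open>A\<close> and \<open>x\<^sub>0\<close>, i.e. when almost surely all positions are nonnegative and nonzero.  The
  path is constrained only up to the explosion time, the supremum of the renewal times.
\<close>

definition polya_walk ::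
  "'a measure \<Rightarrow> real^2^2 \<Rightarrow> real^2 \<Rightarrow> (real \<Rightarrow> 'a \<Rightarrow> real^2) \<Rightarrow> bool" where
  "polya_walk M A x\<^sub>0 X \<longleftrightarrow>
     prob_space M \<and>
     (\<forall>t\<ge>0. X t \<in> borel_measurable M) \<and>
     (\<exists>(W :: nat \<Rightarrow> 'a \<Rightarrow> real) (I :: nat \<Rightarrow> 'a \<Rightarrow> 2).
        (\<forall>n. W n \<in> borel_measurable M) \<and>
        (\<forall>n. I n \<in> measurable M (count_space UNIV)) \<and>
        (\<forall>n. \<forall>s\<ge>0. AE \<omega> in M.
           real_cond_exp M (history M W I n)
               (indicator {\<omega> \<in> space M. W n \<omega> > s}) \<omega> =
             exp (- (renewal_position A x\<^sub>0 I n \<omega> $ 1 + renewal_position A x\<^sub>0 I n \<omega> $ 2) * s)) \<and>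
        (\<forall>n i. AE \<omega> in M.
           real_cond_exp M (history_wait M W I n)
               (indicator {\<omega> \<in> space M. I n \<omega> = i}) \<omega> =
             renewal_position A x\<^sub>0 I n \<omega> $ i /
               (renewal_position A x\<^sub>0 I n \<omega> $ 1 + renewal_position A x\<^sub>0 I n \<omega> $ 2)) \<and>
        (AE \<omega> in M. \<forall>t\<ge>0. \<forall>n.
           renewal_time W n \<omega> \<le> t \<and> t < renewal_time W (Suc n) \<omega> \<longrightarrow>
             X t \<omega> = renewal_position A x\<^sub>0 I n \<omega>))"

end

theory Submission
  imports Defs
begin

text \<open>
  Each renewal adds exactly \<open>\<delta>\<close> to the sum of the two coordinates, whatever its type.  The
  wait that follows \<open>n\<close> renewals is therefore exponential with the deterministic rate \<open>s + \<delta> n\<close>, where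
  \<open>s = X(0) + Y(0)\<close>: conditioning on the types does not change its law, so the clock of the
  walk and its sequence of types are independent.  The position after \<open>n\<close> renewals is
  determined by the number \<open>K\<^sub>n\<close> of renewals of type 1 among them, namely
  \<open>(X(0) + \<alpha> K\<^sub>n, Y(0) + \<delta> n - \<alpha> K\<^sub>n)\<close>.  Hence the expectation is a double series over the
  number \<open>n\<close> of renewals up to time \<open>t\<close> and the value \<open>k\<close> of \<open>K\<^sub>n\<close>, whose weights factorise
  (\<open>prob_occupation\<close>).

  \<^item> The number of renewals is a pure birth process with linear rates, so it is negative binomial:
    it equals \<open>n\<close> with probability
    \<open>p\<^sub>n(t) = e\<^sup>-\<^sup>s\<^sup>t (1 - e\<^sup>-\<^sup>\<delta>\<^sup>t)\<^sup>n (s/\<delta>)\<^sub>n / n!\<close>, with \<open>(a)\<^sub>n\<close> the rising factorial.  The time of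
    the \<open>(n+1)\<close>-st renewal has density \<open>(s + \<delta> n) p\<^sub>n\<close>; the induction rests on the forward
    equation of the birth process, integrated in \<open>birth_prob_convolution\<close>.  That these
    probabilities sum to 1 also shows that the walk does not explode.

  \<^item> The types form a Polya urn.  Multiplying the law of \<open>K\<^sub>n\<close> by \<open>(s/\<delta>)\<^sub>n / n!\<close> cancels the
    denominators \<open>s + \<delta> n\<close> of the drawing probabilities, and leaves weights \<open>b\<^sub>n\<^sub>,\<^sub>k\<close> with a recursion
    whose coefficients are affine in \<open>n\<close> and \<open>k\<close>.  It turns into a first-order differential
    equation for \<open>\<Sum>\<^sub>n b\<^sub>n\<^sub>,\<^sub>k z\<^sup>n\<close>, driven by the series for \<open>k - 1\<close>, with the solution
    \<open>(X(0)/\<alpha>)\<^sub>k / k! (1 - (1-z)\<^bsup>\<alpha>/\<delta>\<^esup>)\<^sup>k (1-z)\<^bsup>-Y(0)/\<delta>\<^esup>\<close>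
    (\<open>occupation_series\<close>).

  A second binomial series, in \<open>k\<close>, gives the closed form
  (\<open>occupation_double_series\<close>).  For the moment generating function the arguments are
  \<open>z = (1 - e\<^sup>-\<^sup>\<delta>\<^sup>t) e\<^sup>\<delta>\<^sup>v\<close> for the number of renewals and \<open>q = e\<^bsup>\<alpha>(u-v)\<^esup>\<close> for the type
  count.  All terms are nonnegative, so both series may be handled as extended nonnegative
  integrals; they converge when \<open>z < 1\<close> and \<open>q (1 - (1-z)\<^bsup>\<alpha>/\<delta>\<^esup>) < 1\<close>, which
  is an open condition that holds at \<open>u = v = 0\<close>.
\<close>

section \<open>Generating function of the type counts\<close>

lemma pochhammer_series:
  fixes a z :: real
  assumes "\<bar>z\<bar> < 1"
  shows "(\<lambda>n. pochhammer a n / fact n * z ^ n) sums (1 - z) powr (- a)"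
proof -
  have "(\<lambda>n. (- a gchoose n) * (- z) ^ n) sums (1 + - z) powr (- a)"
    by (rule gen_binomial_real) (use assms in simp)
  moreover have "(- a gchoose n) * (- z) ^ n = pochhammer a n / fact n * z ^ n" for n
  proof -
    have "(-1::real) ^ n * (-1) ^ n = 1"
      by (simp flip: power_mult_distrib)
    then show ?thesis
      by (simp add: gbinomial_pochhammer power_minus[of z])
  qed
  ultimately show ?thesis by simp
qed

lemma DERIV_one_minus_powr:
  fixes c s :: real
  assumes "s < 1"
  shows "((\<lambda>s. (1 - s) powr c) has_field_derivative - c * (1 - s) powr c / (1 - s)) (at s)"
  using assms by (auto intro!: derivative_eq_intros simp: powr_diff)

text \<open>
  The factor \<open>(1 - s)\<^bsup>a/\<delta>\<^esup>\<close> is the integrating factor of the homogeneous equation, so it makes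
  the difference of two solutions constant.
\<close>

lemma unit_interval_ode_unique:
  fixes f h g :: "real \<Rightarrow> real" and a \<delta> :: real
  assumes \<delta>: "\<delta> > 0"
    and f: "\<And>s. 0 \<le> s \<Longrightarrow> s < 1 \<Longrightarrow> (f has_field_derivative f' s) (at s)"
    and f': "\<And>s. 0 \<le> s \<Longrightarrow> s < 1 \<Longrightarrow> \<delta> * (1 - s) * f' s = a * f s + g s"
    and h: "\<And>s. 0 \<le> s \<Longrightarrow> s < 1 \<Longrightarrow> (h has_field_derivative h' s) (at s)"
    and h': "\<And>s. 0 \<le> s \<Longrightarrow> s < 1 \<Longrightarrow> \<delta> * (1 - s) * h' s = a * h s + g s"
    and init: "f 0 = h 0"
    and z: "0 \<le> z" "z < 1"
  shows "f z = h z"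
proof (cases "z = 0")
  case False
  define d where "d s = (f s - h s) * (1 - s) powr (a / \<delta>)" for s
  have d': "(d has_field_derivative 0) (at s)" if s: "0 \<le> s" "s < 1" for s
  proof -
    have "(d has_field_derivative (f' s - h' s) * (1 - s) powr (a / \<delta>)
        + (- (a / \<delta>) * (1 - s) powr (a / \<delta>) / (1 - s)) * (f s - h s)) (at s)"
      unfolding d_def using s
      by (intro DERIV_mult DERIV_diff DERIV_one_minus_powr f h)
    moreover have "\<delta> * (1 - s) * (f' s - h' s) = a * (f s - h s)"
      using f'[OF s] h'[OF s] by (simp add: algebra_simps)
    then have "f' s - h' s = a * (f s - h s) / (\<delta> * (1 - s))"
      using s \<delta> by (simp add: field_simps)
    ultimately show ?thesis by (simp add: algebra_simps)
  qed
  have "d z = d 0"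
    by (rule DERIV_isconst_end)
      (use False z in \<open>auto intro!: continuous_at_imp_continuous_on DERIV_isCont[OF d'] d'\<close>)
  then show ?thesis using init z by (simp add: d_def)
qed (use init in simp)

text \<open>
  Here \<open>b n k\<close> stands for the probability that \<open>k\<close> of the first \<open>n\<close> renewals have type 1, times
  \<open>pochhammer \<sigma> n / fact n\<close> with \<open>\<sigma>\<close> the total initial mass over \<open>\<delta>\<close>.  The recursion makes the
  power series \<open>H\<close> in column \<open>k\<close> satisfy
  \<open>\<delta> (1 - z) H' = (y - \<alpha> k) H + (x + \<alpha> (k - 1)) H\<^sub>k\<^sub>-\<^sub>1\<close>, and the claimed closed form satisfies the
  same equation with the same value at 0.  The bound on \<open>b\<close> provides convergence for \<open>z < 1\<close>.
\<close>

lemma occupation_series: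
  fixes b :: "nat \<Rightarrow> nat \<Rightarrow> real" and x y \<alpha> \<delta> \<sigma> z :: real
  assumes \<alpha>: "0 < \<alpha>" and \<delta>: "0 < \<delta>"
    and b_0: "\<And>k. b 0 k = of_bool (k = 0)"
    and b_Suc_0: "\<And>n. \<delta> * (n + 1) * b (Suc n) 0 = (y + \<delta> * n) * b n 0"
    and b_Suc_Suc: "\<And>n k. \<delta> * (n + 1) * b (Suc n) (Suc k) =
        (y + \<delta> * n - \<alpha> * (k + 1)) * b n (Suc k) + (x + \<alpha> * k) * b n k"
    and b_bound: "\<And>n k. \<bar>b n k\<bar> \<le> pochhammer \<sigma> n / fact n"
    and z: "0 \<le> z" "z < 1"
  shows "(\<lambda>n. b n k * z ^ n) sums
    (pochhammer (x / \<alpha>) k / fact k * (1 - (1 - z) powr (\<alpha> / \<delta>)) ^ k * (1 - z) powr (- y / \<delta>))"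
proof -
  define H where "H k s = (\<Sum>n. b n k * s ^ n)" for k and s :: real
  define H' where "H' k s = (\<Sum>n. diffs (\<lambda>n. b n k) n * s ^ n)" for k and s :: real
  define F where "F k s = pochhammer (x / \<alpha>) k / fact k * (1 - (1 - s) powr (\<alpha> / \<delta>)) ^ k
      * (1 - s) powr (- y / \<delta>)" for k and s :: real
  \<comment> \<open>\<open>B\<close> and \<open>G\<close> are the inhomogeneous terms, which vanish in column 0.\<close>
  define B where "B k n = (if k = 0 then 0 else (x + \<alpha> * (k - 1)) * b n (k - 1))" for k n :: nat
  define G where "G k s = (if k = 0 then 0 else (x + \<alpha> * (k - 1)) * H (k - 1) s)" for k :: nat and s :: real
  have smm: "summable (\<lambda>n. b n k * s ^ n)" if "\<bar>s\<bar> < 1" for k s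
  proof (rule summable_comparison_test')
    show "summable (\<lambda>n. pochhammer \<sigma> n / fact n * \<bar>s\<bar> ^ n)"
      using pochhammer_series[of "\<bar>s\<bar>" \<sigma>] that by (auto simp: sums_iff)
    show "norm (b n k * s ^ n) \<le> pochhammer \<sigma> n / fact n * \<bar>s\<bar> ^ n" for n
      using mult_right_mono[OF b_bound[of n k], of "\<bar>s\<bar> ^ n"]
      by (simp add: abs_mult power_abs)
  qed
  have H_sums: "(\<lambda>n. b n k * s ^ n) sums H k s" if "\<bar>s\<bar> < 1" for k s
    unfolding H_def using smm[OF that] by (rule summable_sums)
  have H_deriv: "(H k has_field_derivative H' k s) (at s)" if "0 \<le> s" "s < 1" for k s
    unfolding H_def H'_def by (rule termdiffs_strong'[where K = 1]) (use that smm in auto)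
  have H'_sums: "(\<lambda>n. diffs (\<lambda>n. b n k) n * s ^ n) sums H' k s" if "0 \<le> s" "s < 1" for k s
    unfolding H'_def
  proof (rule summable_sums, rule termdiff_converges[where K = 1])
    show "norm s < 1" using that by simp
    show "summable (\<lambda>n. b n k * s' ^ n)" if "norm s' < 1" for s' :: real
      using smm that by simp
  qed
  have B_rec: "\<delta> * diffs (\<lambda>n. b n k) n = (y + \<delta> * n - \<alpha> * k) * b n k + B k n" for n k
  proof (cases k)
    case 0
    then show ?thesis using b_Suc_0[of n] by (simp add: diffs_def B_def algebra_simps)
  next
    case (Suc j)
    then show ?thesis using b_Suc_Suc[of n j] by (simp add: diffs_def B_def algebra_simps)
  qed
  have H_ode: "\<delta> * (1 - s) * H' k s = (y - \<alpha> * k) * H k s + G k s" if s: "0 \<le> s" "s < 1" for k s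
  proof -
    have B_sums: "(\<lambda>n. B k n * s ^ n) sums G k s"
      using sums_mult[OF H_sums[of s "k - 1"], of "x + \<alpha> * (k - 1)"] s
      by (auto simp: B_def G_def mult.assoc)
    have "(\<lambda>n. s * (n * b n k * s ^ (n - Suc 0))) sums (s * H' k s)"
      unfolding H'_def by (intro sums_mult diffs_equiv sums_summable[OF H'_sums[OF s]])
    also have "(\<lambda>n. s * (n * b n k * s ^ (n - Suc 0))) = (\<lambda>n. n * b n k * s ^ n)"
    proof
      show "s * (n * b n k * s ^ (n - Suc 0)) = n * b n k * s ^ n" for n :: nat
        by (cases n) auto
    qed
    finally have "(\<lambda>n. (y - \<alpha> * k) * (b n k * s ^ n) + \<delta> * (n * b n k * s ^ n) + B k n * s ^ n)
        sums ((y - \<alpha> * k) * H k s + \<delta> * (s * H' k s) + G k s)"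
      using s by (intro sums_add sums_mult H_sums B_sums) auto
    moreover have "(\<lambda>n. (y - \<alpha> * k) * (b n k * s ^ n) + \<delta> * (n * b n k * s ^ n) + B k n * s ^ n)
        = (\<lambda>n. \<delta> * (diffs (\<lambda>n. b n k) n * s ^ n))"
    proof
      fix n :: nat
      have "\<delta> * (diffs (\<lambda>n. b n k) n * s ^ n) = (\<delta> * diffs (\<lambda>n. b n k) n) * s ^ n" by simp
      also have "\<dots> = ((y + \<delta> * n - \<alpha> * k) * b n k + B k n) * s ^ n" by (simp only: B_rec)
      finally show "(y - \<alpha> * k) * (b n k * s ^ n) + \<delta> * (n * b n k * s ^ n) + B k n * s ^ n
          = \<delta> * (diffs (\<lambda>n. b n k) n * s ^ n)"
        by (simp add: algebra_simps)
    qed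
    moreover have "(\<lambda>n. \<delta> * (diffs (\<lambda>n. b n k) n * s ^ n)) sums (\<delta> * H' k s)"
      by (intro sums_mult H'_sums s)
    ultimately have "\<delta> * H' k s = (y - \<alpha> * k) * H k s + \<delta> * (s * H' k s) + G k s"
      using sums_unique2 by force
    then show ?thesis by (simp add: algebra_simps)
  qed
  have H_init: "H k 0 = F k 0" for k
  proof -
    have "H k 0 = b 0 k" by (simp add: H_def)
    then show ?thesis by (simp add: F_def b_0 power_0_left)
  qed
  have "H k s = F k s" if "0 \<le> s" "s < 1" for s
    using that
  proof (induction k arbitrary: s)
    case 0
    define F' where "F' s = - (- y / \<delta>) * (1 - s) powr (- y / \<delta>) / (1 - s)" for s
    show ?case
    proof (rule unit_interval_ode_unique[OF \<delta> H_deriv _ _ _ _ 0, where a = y and g = "\<lambda>_. 0" and h' = F'])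
      fix s :: real assume s: "0 \<le> s" "s < 1"
      show "\<delta> * (1 - s) * H' 0 s = y * H 0 s + 0" using H_ode[OF s, of 0] by (simp add: G_def)
      show "(F 0 has_field_derivative F' s) (at s)"
        unfolding F_def F'_def using DERIV_one_minus_powr[of s "- y / \<delta>"] s by simp
      show "\<delta> * (1 - s) * F' s = y * F 0 s + 0" using s \<delta> by (simp add: F_def F'_def)
    qed (use H_init in auto)
  next
    case (Suc k)
    \<comment> \<open>With \<open>R = (1 - s)\<^bsup>\<alpha>/\<delta>\<^esup>\<close> the derivative of \<open>(1 - R)\<^bsup>k+1\<^esup>\<close> contains a factor \<open>R = 1 - (1 - R)\<close>; its two summands yield the driving term and the coefficient \<open>- \<alpha> (k + 1)\<close>.\<close>
    define c where "c = pochhammer (x / \<alpha>) (Suc k) / fact (Suc k)"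
    define R where "R s = (1 - s) powr (\<alpha> / \<delta>)" for s
    define R' where "R' s = - (\<alpha> / \<delta>) * R s / (1 - s)" for s
    define C where "C s = (1 - s) powr (- y / \<delta>)" for s
    define C' where "C' s = - (- y / \<delta>) * C s / (1 - s)" for s
    define F' where "F' s = c * ((k + 1) * (1 - R s) ^ k * (- R' s)) * C s + c * (1 - R s) ^ Suc k * C' s" for s
    have F_Suc: "F (Suc k) s = c * (1 - R s) ^ Suc k * C s" for s by (simp add: F_def c_def R_def C_def)
    have ck: "(x + \<alpha> * k) * F k s = \<alpha> * (k + 1) * c * (1 - R s) ^ k * C s" for s
    proof -
      have "\<alpha> * (k + 1) * c = (x + \<alpha> * k) * (pochhammer (x / \<alpha>) k / fact k)"
      proof -
        have "\<alpha> * (x / \<alpha> + k) = x + \<alpha> * k" using \<alpha> by (simp add: algebra_simps)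
        moreover have "(k + 1) * c = (x / \<alpha> + k) * (pochhammer (x / \<alpha>) k / fact k)"
          by (simp add: c_def pochhammer_Suc)
        ultimately show ?thesis by (metis mult.assoc)
      qed
      then show ?thesis by (simp add: F_def R_def C_def)
    qed
    show ?case
    proof (rule unit_interval_ode_unique[OF \<delta> H_deriv _ _ _ _ Suc.prems,
          where a = "y - \<alpha> * Suc k" and g = "\<lambda>s. (x + \<alpha> * k) * F k s" and h' = F'])
      fix s :: real assume s: "0 \<le> s" "s < 1"
      show "\<delta> * (1 - s) * H' (Suc k) s = (y - \<alpha> * Suc k) * H (Suc k) s + (x + \<alpha> * k) * F k s"
        using H_ode[OF s, of "Suc k"] Suc.IH[OF s] by (simp add: G_def)
      have R: "(R has_field_derivative R' s) (at s)"
        unfolding R_def R'_def by (rule DERIV_one_minus_powr) (use s in simp)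
      have C: "(C has_field_derivative C' s) (at s)"
        unfolding C_def C'_def by (rule DERIV_one_minus_powr) (use s in simp)
      show "(F (Suc k) has_field_derivative F' s) (at s)"
        unfolding F_Suc F'_def by (auto intro!: derivative_eq_intros R C simp del: power_Suc)
      have R's: "\<delta> * (1 - s) * R' s = - \<alpha> * R s" using s \<delta> by (simp add: R'_def field_simps)
      have C's: "\<delta> * (1 - s) * C' s = y * C s" using s \<delta> by (simp add: C'_def field_simps)
      have "\<delta> * (1 - s) * F' s = c * (k + 1) * (1 - R s) ^ k * C s * (- (\<delta> * (1 - s) * R' s))
          + c * (1 - R s) ^ Suc k * (\<delta> * (1 - s) * C' s)"
        unfolding F'_def by (simp add: algebra_simps del: power_Suc)
      also have "\<dots> = c * (k + 1) * (1 - R s) ^ k * C s * (\<alpha> * R s) + c * (1 - R s) ^ Suc k * (y * C s)"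
        by (simp only: R's C's minus_mult_left minus_minus)
      also have "\<dots> = (y - \<alpha> * Suc k) * F (Suc k) s + \<alpha> * (k + 1) * c * (1 - R s) ^ k * C s"
        unfolding F_Suc by (simp add: algebra_simps)
      finally show "\<delta> * (1 - s) * F' s = (y - \<alpha> * Suc k) * F (Suc k) s + (x + \<alpha> * k) * F k s"
        by (simp add: ck)
    qed (use H_init in auto)
  qed
  with H_sums[of z k] z show ?thesis by (simp add: F_def)
qed

text \<open>
  Nonnegativity allows the columns to be summed first; what remains is the binomial series in
  \<open>q (1 - (1 - z)\<^bsup>\<alpha>/\<delta>\<^esup>)\<close>.
\<close>

lemma occupation_double_series:
  fixes b :: "nat \<Rightarrow> nat \<Rightarrow> real" and x y \<alpha> \<delta> \<sigma> z q :: real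
  assumes \<alpha>: "0 < \<alpha>" and \<delta>: "0 < \<delta>" and x: "0 \<le> x"
    and b_0: "\<And>k. b 0 k = of_bool (k = 0)"
    and b_Suc_0: "\<And>n. \<delta> * (n + 1) * b (Suc n) 0 = (y + \<delta> * n) * b n 0"
    and b_Suc_Suc: "\<And>n k. \<delta> * (n + 1) * b (Suc n) (Suc k) =
        (y + \<delta> * n - \<alpha> * (k + 1)) * b n (Suc k) + (x + \<alpha> * k) * b n k"
    and b_nonneg: "\<And>n k. 0 \<le> b n k"
    and b_bound: "\<And>n k. b n k \<le> pochhammer \<sigma> n / fact n"
    and z: "0 \<le> z" "z < 1" and q: "0 \<le> q" "q * (1 - (1 - z) powr (\<alpha> / \<delta>)) < 1"
  shows "(\<Sum>n. \<Sum>k. ennreal (b n k * z ^ n * q ^ k)) =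
    ennreal ((1 - q * (1 - (1 - z) powr (\<alpha> / \<delta>))) powr (- x / \<alpha>) * (1 - z) powr (- y / \<delta>))"
proof -
  define r where "r = 1 - (1 - z) powr (\<alpha> / \<delta>)"
  have r: "0 \<le> r" using z \<alpha> \<delta> by (simp add: r_def powr_le1)
  have F: "(\<lambda>n. b n k * z ^ n) sums (pochhammer (x / \<alpha>) k / fact k * r ^ k * (1 - z) powr (- y / \<delta>))" for k
    unfolding r_def
    by (rule occupation_series[OF \<alpha> \<delta> b_0 b_Suc_0 b_Suc_Suc _ z]) (use b_nonneg b_bound in auto)
  have "(\<Sum>n. \<Sum>k. ennreal (b n k * z ^ n * q ^ k)) = (\<Sum>k. \<Sum>n. ennreal (b n k * z ^ n * q ^ k))"
    using nn_integral_suminf[of "\<lambda>k n. ennreal (b n k * z ^ n * q ^ k)" "count_space UNIV"]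
    by (simp add: nn_integral_count_space_nat)
  also have "\<dots> = (\<Sum>k. ennreal (pochhammer (x / \<alpha>) k / fact k * (q * r) ^ k * (1 - z) powr (- y / \<delta>)))"
  proof (rule suminf_cong, rule suminf_ennreal_eq)
    show "0 \<le> b n k * z ^ n * q ^ k" for n k using b_nonneg z q by simp
    show "(\<lambda>n. b n k * z ^ n * q ^ k) sums
        (pochhammer (x / \<alpha>) k / fact k * (q * r) ^ k * (1 - z) powr (- y / \<delta>))" for k
      using sums_mult2[OF F[of k], of "q ^ k"] by (simp add: power_mult_distrib mult_ac)
  qed
  also have "\<dots> = ennreal ((1 - q * r) powr (- (x / \<alpha>)) * (1 - z) powr (- y / \<delta>))"
  proof (rule suminf_ennreal_eq)
    have "\<bar>q * r\<bar> < 1" using q r by (simp add: r_def[symmetric])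
    then show "(\<lambda>k. pochhammer (x / \<alpha>) k / fact k * (q * r) ^ k * (1 - z) powr (- y / \<delta>))
        sums ((1 - q * r) powr (- (x / \<alpha>)) * (1 - z) powr (- y / \<delta>))"
      by (intro sums_mult2 pochhammer_series)
    show "0 \<le> pochhammer (x / \<alpha>) k / fact k * (q * r) ^ k * (1 - z) powr (- y / \<delta>)" for k
    proof -
      have "0 \<le> pochhammer (x / \<alpha>) k"
        using x \<alpha> by (simp add: pochhammer_prod prod_nonneg)
      then show ?thesis using q r by simp
    qed
  qed
  finally show ?thesis by (simp add: r_def)
qed

section \<open>Renewal times, type counts and the histories\<close>

definition type_count :: "(nat \<Rightarrow> 'a \<Rightarrow> 2) \<Rightarrow> nat \<Rightarrow> 'a \<Rightarrow> nat" where
  "type_count I n \<omega> = (\<Sum>k<n. if I k \<omega> = 1 then 1 else 0)"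

lemma type_count_0 [simp]: "type_count I 0 \<omega> = 0"
  by (simp add: type_count_def)

lemma type_count_Suc: "type_count I (Suc n) \<omega> = type_count I n \<omega> + (if I n \<omega> = 1 then 1 else 0)"
  by (simp add: type_count_def)

lemma renewal_time_Suc: "renewal_time W (Suc n) \<omega> = renewal_time W n \<omega> + W n \<omega>"
  by (simp add: renewal_time_def)

lemma measurable_type_count:
  assumes "\<And>k. k < n \<Longrightarrow> I k \<in> N \<rightarrow>\<^sub>M count_space UNIV"
  shows "type_count I n \<in> N \<rightarrow>\<^sub>M count_space UNIV"
  using assms
proof (induction n)
  case 0
  then show ?case by (simp add: type_count_def[abs_def])
next
  case (Suc n)
  have [measurable]: "type_count I n \<in> N \<rightarrow>\<^sub>M count_space UNIV" "I n \<in> N \<rightarrow>\<^sub>M count_space UNIV"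
    using Suc by auto
  show ?case unfolding type_count_Suc[abs_def] by measurable
qed

lemma measurable_renewal_time:
  assumes "\<And>k. k < n \<Longrightarrow> W k \<in> borel_measurable N"
  shows "renewal_time W n \<in> borel_measurable N"
  unfolding renewal_time_def[abs_def] using assms by (intro borel_measurable_sum) auto

lemma measurable_history:
  assumes "k < n"
  shows "W k \<in> borel_measurable (history M W I n)"
    and "I k \<in> history M W I n \<rightarrow>\<^sub>M count_space UNIV"
proof -
  let ?P = "Pi\<^sub>M {..<n} (\<lambda>_. borel \<Otimes>\<^sub>M count_space UNIV) :: (nat \<Rightarrow> real \<times> 2) measure"
  have "(\<lambda>\<omega>. \<lambda>k\<in>{..<n}. (W k \<omega>, I k \<omega>)) \<in> history M W I n \<rightarrow>\<^sub>M ?P"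
    unfolding history_def
    by (rule measurable_vimage_algebra1) (auto simp: space_PiM space_pair_measure)
  from measurable_component_singleton'[OF this measurable_ident_sets[OF refl], of k] assms
  have *: "(\<lambda>\<omega>. (W k \<omega>, I k \<omega>)) \<in> history M W I n \<rightarrow>\<^sub>M borel \<Otimes>\<^sub>M count_space UNIV" by simp
  show "W k \<in> borel_measurable (history M W I n)"
    using measurable_compose[OF * measurable_fst] by simp
  show "I k \<in> history M W I n \<rightarrow>\<^sub>M count_space UNIV"
    using measurable_compose[OF * measurable_snd] by simp
qed

lemma measurable_history_wait:
  shows "k < n \<Longrightarrow> W k \<in> borel_measurable (history_wait M W I n)"
    and "k < n \<Longrightarrow> I k \<in> history_wait M W I n \<rightarrow>\<^sub>M count_space UNIV"
    and "W n \<in> borel_measurable (history_wait M W I n)"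
proof -
  let ?P = "Pi\<^sub>M {..<n} (\<lambda>_. borel \<Otimes>\<^sub>M count_space UNIV) :: (nat \<Rightarrow> real \<times> 2) measure"
  have f: "(\<lambda>\<omega>. (\<lambda>k\<in>{..<n}. (W k \<omega>, I k \<omega>), W n \<omega>)) \<in> history_wait M W I n \<rightarrow>\<^sub>M ?P \<Otimes>\<^sub>M borel"
    unfolding history_wait_def
    by (rule measurable_vimage_algebra1) (auto simp: space_PiM space_pair_measure)
  show "W n \<in> borel_measurable (history_wait M W I n)"
    using measurable_compose[OF f measurable_snd] by simp
  assume "k < n"
  with measurable_component_singleton'[OF measurable_compose[OF f measurable_fst]
      measurable_ident_sets[OF refl], of k]
  have *: "(\<lambda>\<omega>. (W k \<omega>, I k \<omega>)) \<in> history_wait M W I n \<rightarrow>\<^sub>M borel \<Otimes>\<^sub>M count_space UNIV" by simp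
  show "W k \<in> borel_measurable (history_wait M W I n)"
    using measurable_compose[OF * measurable_fst] by simp
  show "I k \<in> history_wait M W I n \<rightarrow>\<^sub>M count_space UNIV"
    using measurable_compose[OF * measurable_snd] by simp
qed

text \<open>
  Knowing the law of \<open>T\<close> restricted to \<open>E\<close> on Borel sets suffices to integrate functions of \<open>T\<close>
  over \<open>E\<close>.
\<close>

lemma nn_integral_density_on_event:
  fixes T :: "'a \<Rightarrow> real" and f :: "real \<Rightarrow> ennreal"
  assumes [measurable]: "T \<in> borel_measurable M" "E \<in> sets M" "f \<in> borel_measurable borel"
    and law: "\<And>B. B \<in> sets borel \<Longrightarrow>
      emeasure M ({\<omega> \<in> space M. T \<omega> \<in> B} \<inter> E) = (\<integral>\<^sup>+ r. f r * indicator B r \<partial>lborel)"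
    and [measurable]: "g \<in> borel_measurable borel"
  shows "(\<integral>\<^sup>+ \<omega>. indicator E \<omega> * g (T \<omega>) \<partial>M) = (\<integral>\<^sup>+ r. f r * g r \<partial>lborel)"
proof -
  have "distr (density M (indicator E)) borel T = density lborel f"
  proof (rule measure_eqI)
    fix B assume "B \<in> sets (distr (density M (indicator E)) borel T)"
    then have B [measurable]: "B \<in> sets borel" by simp
    have "emeasure (distr (density M (indicator E)) borel T) B
        = emeasure (density M (indicator E)) {\<omega> \<in> space M. T \<omega> \<in> B}"
      by (simp add: emeasure_distr vimage_def Int_def conj_commute)
    also have "\<dots> = emeasure M ({\<omega> \<in> space M. T \<omega> \<in> B} \<inter> E)"
      by (simp add: emeasure_density Int_commute flip: indicator_inter_arith)
    finally show "emeasure (distr (density M (indicator E)) borel T) B = emeasure (density lborel f) B"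
      by (simp add: law emeasure_density)
  qed simp
  then have "(\<integral>\<^sup>+ r. g r \<partial>distr (density M (indicator E)) borel T) = (\<integral>\<^sup>+ r. g r \<partial>density lborel f)"
    by simp
  then show ?thesis by (simp add: nn_integral_distr nn_integral_density)
qed

lemma exponential_tail:
  fixes l r :: real
  assumes l: "0 < l" and r: "0 \<le> r"
  shows "(\<integral>\<^sup>+ w. ennreal (exponential_density l w) * indicator {r<..} w \<partial>lborel) = ennreal (exp (- l * r))"
proof -
  interpret E: prob_space "density lborel (exponential_density l)"
    by (rule prob_space_exponential_density[OF l])
  have "E.prob {..r} = 1 - exp (- l * r)"
    using emeasure_erlang_density[OF l, of 0 r] l r
    by (simp add: E.emeasure_eq_measure erlang_CDF_0)
  moreover have "E.prob {r<..} = 1 - E.prob {..r}"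
    using E.prob_compl[of "{..r}"] by (simp add: Compl_eq_Diff_UNIV[symmetric])
  ultimately have "emeasure (density lborel (exponential_density l)) {r<..} = ennreal (exp (- l * r))"
    by (simp add: E.emeasure_eq_measure)
  then show ?thesis by (simp add: emeasure_density)
qed

section \<open>The pure birth process with linear rates\<close>

text \<open>
  The probability that the pure birth process with rates \<open>s + \<delta> n\<close> has had exactly \<open>n\<close> births by
  time \<open>t\<close>.
\<close>

definition birth_prob :: "real \<Rightarrow> real \<Rightarrow> nat \<Rightarrow> real \<Rightarrow> real" where
  "birth_prob s \<delta> n t = exp (- s * t) * (1 - exp (- \<delta> * t)) ^ n * (pochhammer (s / \<delta>) n / fact n)"

lemma birth_prob_nonneg: "0 < s \<Longrightarrow> 0 < \<delta> \<Longrightarrow> 0 \<le> t \<Longrightarrow> 0 \<le> birth_prob s \<delta> n t"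
  by (simp add: birth_prob_def pochhammer_prod prod_nonneg)

lemma birth_prob_measurable [measurable]: "birth_prob s \<delta> n \<in> borel_measurable borel"
  unfolding birth_prob_def[abs_def] by measurable

lemma birth_prob_sums:
  assumes "0 < \<delta>" "0 \<le> t"
  shows "(\<lambda>n. birth_prob s \<delta> n t) sums 1"
proof -
  have "\<bar>1 - exp (- \<delta> * t)\<bar> < 1" using assms by simp
  from sums_mult[OF pochhammer_series[OF this, of "s / \<delta>"], of "exp (- s * t)"]
  have "(\<lambda>n. birth_prob s \<delta> n t) sums (exp (- s * t) * exp (- \<delta> * t) powr (- (s / \<delta>)))"
    by (simp add: birth_prob_def mult_ac)
  moreover have "exp (- s * t) * exp (- \<delta> * t) powr (- (s / \<delta>)) = 1"
    using assms by (simp add: powr_def flip: exp_add)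
  ultimately show ?thesis by simp
qed

text \<open>
  The forward equation \<open>p\<^sub>n\<^sub>+\<^sub>1' = (s + \<delta> n) p\<^sub>n - (s + \<delta> (n + 1)) p\<^sub>n\<^sub>+\<^sub>1\<close> in integrated form: the
  \<open>(n + 1)\<close>-st birth occurs at some time \<open>r \<le> t\<close>, and the next waiting time exceeds \<open>t - r\<close>.
\<close>

lemma birth_prob_convolution:
  fixes s \<delta> t :: real and n :: nat
  assumes s: "0 < s" and \<delta>: "0 < \<delta>" and t: "0 \<le> t"
  shows "(\<integral>\<^sup>+ r. ennreal ((s + \<delta> * n) * birth_prob s \<delta> n r * exp (- (s + \<delta> * Suc n) * (t - r)))
      * indicator {0..t} r \<partial>lborel) = ennreal (birth_prob s \<delta> (Suc n) t)"
proof -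
  let ?l = "s + \<delta> * Suc n"
  \<comment> \<open>Multiplying by \<open>e\<^bsup>(s + \<delta> (n + 1)) r\<^esup>\<close> makes the integrand an exact derivative.\<close>
  define F where "F r = exp (- ?l * (t - r)) * birth_prob s \<delta> (Suc n) r" for r
  define c where "c = pochhammer (s / \<delta>) n / fact n"
  have c: "(n + 1) * \<delta> * (pochhammer (s / \<delta>) (Suc n) / fact (Suc n)) = (s + \<delta> * n) * c"
  proof -
    have "\<delta> * (s / \<delta> + n) = s + \<delta> * n" using \<delta> by (simp add: algebra_simps)
    moreover have "(n + 1) * (pochhammer (s / \<delta>) (Suc n) / fact (Suc n)) = (s / \<delta> + n) * c"
      by (simp add: c_def pochhammer_Suc)
    ultimately show ?thesis by (metis mult.assoc mult.commute)
  qed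
  define C where "C = pochhammer (s / \<delta>) (Suc n) / fact (Suc n)"
  have deriv: "(F has_field_derivative (s + \<delta> * n) * birth_prob s \<delta> n r * exp (- ?l * (t - r))) (at r)" for r
  proof -
    have F: "F = (\<lambda>r. exp (- ?l * (t - r)) * (exp (- s * r) * (1 - exp (- \<delta> * r)) ^ Suc n * C))"
      by (simp add: F_def[abs_def] birth_prob_def C_def)
    have "(F has_field_derivative
        exp (- ?l * (t - r)) * exp (- s * r) * ((n + 1) * \<delta> * C) * (1 - exp (- \<delta> * r)) ^ n) (at r)"
      unfolding F
      by (auto intro!: derivative_eq_intros simp del: power_Suc) (simp add: algebra_simps)
    also have "exp (- ?l * (t - r)) * exp (- s * r) * ((n + 1) * \<delta> * C) * (1 - exp (- \<delta> * r)) ^ n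
        = (s + \<delta> * n) * birth_prob s \<delta> n r * exp (- ?l * (t - r))"
      unfolding C_def c by (simp add: birth_prob_def c_def)
    finally show ?thesis .
  qed
  have "(\<integral>\<^sup>+ r. ennreal ((s + \<delta> * n) * birth_prob s \<delta> n r * exp (- ?l * (t - r)))
      * indicator {0..t} r \<partial>lborel) = F t - F 0"
  proof (rule nn_integral_FTC_Icc)
    show "(F has_real_derivative (s + \<delta> * n) * birth_prob s \<delta> n r * exp (- ?l * (t - r))) (at r)" for r
      by (rule deriv)
    show "0 \<le> (s + \<delta> * n) * birth_prob s \<delta> n r * exp (- ?l * (t - r))" if "r \<in> {0..t}" for r
      using that s \<delta> by (intro mult_nonneg_nonneg birth_prob_nonneg) auto
  qed (use t in auto)
  then show ?thesis by (simp add: F_def birth_prob_def)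
qed

section \<open>Joint law of the clock and the type count\<close>

text \<open>
  Renewals of a walk whose total mass grows by \<open>\<delta>\<close> at every renewal: the rates are deterministic,
  and the drawing probabilities depend on the past through the type count only.
\<close>

locale balanced_renewals = prob_space M for M :: "'a measure" +
  fixes W :: "nat \<Rightarrow> 'a \<Rightarrow> real" and I :: "nat \<Rightarrow> 'a \<Rightarrow> 2"
    and s \<delta> :: real and \<pi> :: "nat \<Rightarrow> nat \<Rightarrow> real"
  assumes W_measurable [measurable]: "\<And>n. W n \<in> borel_measurable M"
    and I_measurable [measurable]: "\<And>n. I n \<in> M \<rightarrow>\<^sub>M count_space UNIV"
    and s_pos: "0 < s" and \<delta>_pos: "0 < \<delta>"
    and wait_cond: "\<And>n r. 0 \<le> r \<Longrightarrow> AE \<omega> in M.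
        real_cond_exp M (history M W I n) (indicator {\<omega> \<in> space M. r < W n \<omega>}) \<omega> =
          exp (- (s + \<delta> * n) * r)"
    and type_cond: "\<And>n. AE \<omega> in M.
        real_cond_exp M (history_wait M W I n) (indicator {\<omega> \<in> space M. I n \<omega> = 1}) \<omega> =
          \<pi> n (type_count I n \<omega>)"
begin

abbreviation T :: "nat \<Rightarrow> 'a \<Rightarrow> real" where "T \<equiv> renewal_time W"

abbreviation K :: "nat \<Rightarrow> 'a \<Rightarrow> nat" where "K \<equiv> type_count I"

abbreviation rate :: "nat \<Rightarrow> real" where "rate n \<equiv> s + \<delta> * real n"

lemma rate_pos: "0 < rate n"
  using s_pos \<delta>_pos by (simp add: add_pos_nonneg)

lemma T_measurable [measurable]: "T n \<in> borel_measurable M"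
  by (rule measurable_renewal_time) simp

lemma K_measurable [measurable]: "K n \<in> M \<rightarrow>\<^sub>M count_space UNIV"
  by (rule measurable_type_count) simp

lemma history_subalgebra: "finite_measure_subalgebra M (history M W I n)"
proof unfold_locales
  have "sets (history M W I n) \<subseteq> sets M"
    unfolding history_def by (rule sets_image_in_sets) measurable
  then show "subalgebra M (history M W I n)"
    by (simp add: subalgebra_def history_def)
qed

lemma history_wait_subalgebra: "finite_measure_subalgebra M (history_wait M W I n)"
proof unfold_locales
  have "sets (history_wait M W I n) \<subseteq> sets M"
    unfolding history_wait_def by (rule sets_image_in_sets) measurable
  then show "subalgebra M (history_wait M W I n)"
    by (simp add: subalgebra_def history_wait_def)
qed

lemma prob_history_wait:
  assumes A: "A \<in> sets (history M W I n)" and r: "0 \<le> r"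
  shows "prob (A \<inter> {\<omega> \<in> space M. r < W n \<omega>}) = prob A * exp (- rate n * r)"
proof -
  interpret H: finite_measure_subalgebra M "history M W I n" by (rule history_subalgebra)
  let ?E = "{\<omega> \<in> space M. r < W n \<omega>}"
  have AM [measurable]: "A \<in> sets M" using A H.subalg by (auto simp: subalgebra_def)
  have "prob (A \<inter> ?E) = (\<integral>\<omega>\<in>A. indicator ?E \<omega> \<partial>M)"
    by (simp add: set_lebesgue_integral_def flip: indicator_inter_arith)
  also have "\<dots> = (\<integral>\<omega>\<in>A. real_cond_exp M (history M W I n) (indicator ?E) \<omega> \<partial>M)"
    by (rule H.real_cond_exp_intA[OF integrable_real_indicator A]) (auto simp: emeasure_eq_measure)
  also have "\<dots> = (\<integral>\<omega>. indicator A \<omega> * exp (- rate n * r) \<partial>M)"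
    unfolding set_lebesgue_integral_def
    using wait_cond[OF r, of n] by (intro integral_cong_AE) auto
  finally show ?thesis by simp
qed

text \<open>
  A conditional law that does not depend on the history means independence from the history.
\<close>

lemma law_history_wait:
  assumes Z: "Z \<in> history M W I n \<rightarrow>\<^sub>M N"
  shows "distr M N Z \<Otimes>\<^sub>M density lborel (exponential_density (rate n)) =
    distr M (N \<Otimes>\<^sub>M borel) (\<lambda>\<omega>. (Z \<omega>, W n \<omega>))"
proof (rule pair_measure_eqI)
  interpret H: finite_measure_subalgebra M "history M W I n" by (rule history_subalgebra)
  interpret D: prob_space "density lborel (exponential_density (rate n))"
    by (rule prob_space_exponential_density[OF rate_pos])
  have ZM [measurable]: "Z \<in> M \<rightarrow>\<^sub>M N"
    by (rule measurable_from_subalg[OF H.subalg Z])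
  show "sigma_finite_measure (distr M N Z)"
    using prob_space_distr[OF ZM] by (rule prob_space_imp_sigma_finite)
  show "sigma_finite_measure (density lborel (exponential_density (rate n)))"
    by (rule D.sigma_finite_measure_axioms)
  show "sets (distr M N Z \<Otimes>\<^sub>M density lborel (exponential_density (rate n))) =
      sets (distr M (N \<Otimes>\<^sub>M borel) (\<lambda>\<omega>. (Z \<omega>, W n \<omega>)))"
    by (simp cong: sets_pair_measure_cong)
  fix A B
  assume "A \<in> sets (distr M N Z)" and "B \<in> sets (density lborel (exponential_density (rate n)))"
  then have [measurable]: "A \<in> sets N" "B \<in> sets borel" by auto
  define E where "E = Z -` A \<inter> space M"
  have E: "E \<in> sets (history M W I n)"
    using measurable_sets[OF Z \<open>A \<in> sets N\<close>] H.subalg by (simp add: E_def subalgebra_def)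
  have [measurable]: "E \<in> sets M" by (simp add: E_def)
  \<comment> \<open>Restricted to an event of the history, \<open>W n\<close> still has the exponential law, scaled by the probability of the event; tails determine the measure.\<close>
  have eq: "distr (density M (indicator E)) borel (W n) =
      scale_measure (prob E) (density lborel (exponential_density (rate n)))"
  proof (rule measure_eqI_lessThan)
    fix r :: real
    define r' where "r' = max 0 r"
    have lhs: "emeasure (distr (density M (indicator E)) borel (W n)) {r<..}
        = prob (E \<inter> {\<omega> \<in> space M. r < W n \<omega>})" for r
    proof -
      have "W n -` {r<..} \<inter> space M = {\<omega> \<in> space M. r < W n \<omega>}" by auto
      then show ?thesis
        by (simp add: emeasure_distr emeasure_density emeasure_eq_measure flip: indicator_inter_arith)
    qed
    have rhs: "emeasure (density lborel (exponential_density (rate n))) {r<..} = exp (- rate n * r')"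
    proof -
      have "emeasure (density lborel (exponential_density (rate n))) {r<..} =
          (\<integral>\<^sup>+ w. ennreal (exponential_density (rate n) w) * indicator {r'<..} w \<partial>lborel)"
      proof -
        have "AE w in lborel. ennreal (exponential_density (rate n) w) * indicator {r<..} w =
            ennreal (exponential_density (rate n) w) * indicator {r'<..} w"
          using AE_lborel_singleton[of "0::real"]
          by (rule eventually_mono)
             (auto simp: r'_def exponential_density_def max_def split: split_indicator)
        then show ?thesis
          by (subst emeasure_density) (auto intro: nn_integral_cong_AE)
      qed
      then show ?thesis
        using exponential_tail[OF rate_pos, of r' n] by (simp add: r'_def)
    qed
    have "prob (E \<inter> {\<omega> \<in> space M. r < W n \<omega>}) = prob E * exp (- rate n * r')"
    \<comment> \<open>For negative \<open>r\<close> the event contains \<open>{0 < W n}\<close>, which already has full probability.\<close>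
    proof (cases "0 \<le> r")
      case True
      then show ?thesis using prob_history_wait[OF E True] by (simp add: r'_def)
    next
      case False
      have "prob (E \<inter> {\<omega> \<in> space M. 0 < W n \<omega>}) \<le> prob (E \<inter> {\<omega> \<in> space M. r < W n \<omega>})"
        using False by (intro finite_measure_mono) auto
      moreover have "prob (E \<inter> {\<omega> \<in> space M. r < W n \<omega>}) \<le> prob E"
        by (intro finite_measure_mono) auto
      ultimately show ?thesis using prob_history_wait[OF E, of 0] False by (simp add: r'_def)
    qed
    then show "emeasure (distr (density M (indicator E)) borel (W n)) {r<..}
        = emeasure (scale_measure (prob E) (density lborel (exponential_density (rate n)))) {r<..}"
      by (simp add: lhs rhs ennreal_mult)
    show "emeasure (distr (density M (indicator E)) borel (W n)) {r<..} < \<infinity>"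
      by (simp add: lhs)
  qed simp_all
  have "(\<lambda>\<omega>. (Z \<omega>, W n \<omega>)) -` (A \<times> B) \<inter> space M = E \<inter> (W n -` B \<inter> space M)"
    by (auto simp: E_def)
  then have joint: "emeasure (distr M (N \<Otimes>\<^sub>M borel) (\<lambda>\<omega>. (Z \<omega>, W n \<omega>))) (A \<times> B)
      = emeasure (distr (density M (indicator E)) borel (W n)) B"
    by (simp add: emeasure_distr emeasure_density flip: indicator_inter_arith)
  have "emeasure (distr M N Z) A = prob E"
    by (simp add: emeasure_distr E_def emeasure_eq_measure)
  then show "emeasure (distr M N Z) A * emeasure (density lborel (exponential_density (rate n))) B =
      emeasure (distr M (N \<Otimes>\<^sub>M borel) (\<lambda>\<omega>. (Z \<omega>, W n \<omega>))) (A \<times> B)"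
    by (simp only: joint eq emeasure_scale_measure)
qed

lemma nn_integral_history_wait:
  assumes Z: "Z \<in> history M W I n \<rightarrow>\<^sub>M N" and f [measurable]: "f \<in> borel_measurable (N \<Otimes>\<^sub>M borel)"
  shows "(\<integral>\<^sup>+ \<omega>. f (Z \<omega>, W n \<omega>) \<partial>M) =
    (\<integral>\<^sup>+ \<omega>. (\<integral>\<^sup>+ w. ennreal (exponential_density (rate n) w) * f (Z \<omega>, w) \<partial>lborel) \<partial>M)"
proof -
  interpret H: finite_measure_subalgebra M "history M W I n" by (rule history_subalgebra)
  interpret D: prob_space "density lborel (exponential_density (rate n))"
    by (rule prob_space_exponential_density[OF rate_pos])
  have ZM [measurable]: "Z \<in> M \<rightarrow>\<^sub>M N"
    by (rule measurable_from_subalg[OF H.subalg Z])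
  have "(\<integral>\<^sup>+ \<omega>. f (Z \<omega>, W n \<omega>) \<partial>M) = (\<integral>\<^sup>+ p. f p \<partial>distr M (N \<Otimes>\<^sub>M borel) (\<lambda>\<omega>. (Z \<omega>, W n \<omega>)))"
    by (simp add: nn_integral_distr)
  also have "\<dots> = (\<integral>\<^sup>+ a. (\<integral>\<^sup>+ w. f (a, w) \<partial>density lborel (exponential_density (rate n))) \<partial>distr M N Z)"
    unfolding law_history_wait[OF Z, symmetric]
    by (subst D.nn_integral_fst) (simp_all cong: measurable_cong_sets sets_pair_measure_cong)
  also have "\<dots> = (\<integral>\<^sup>+ a. (\<integral>\<^sup>+ w. ennreal (exponential_density (rate n) w) * f (a, w) \<partial>lborel) \<partial>distr M N Z)"
    by (intro nn_integral_cong nn_integral_density) auto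
  finally show ?thesis by (simp add: nn_integral_distr)
qed

lemma prob_history_wait_type:
  assumes A: "A \<in> sets (history_wait M W I n)" and k: "A \<subseteq> {\<omega>. K n \<omega> = k}"
  shows "prob (A \<inter> {\<omega> \<in> space M. I n \<omega> = 1}) = \<pi> n k * prob A"
    and "prob (A \<inter> {\<omega> \<in> space M. I n \<omega> \<noteq> 1}) = (1 - \<pi> n k) * prob A"
proof -
  interpret H: finite_measure_subalgebra M "history_wait M W I n" by (rule history_wait_subalgebra)
  let ?E = "{\<omega> \<in> space M. I n \<omega> = 1}"
  have AM [measurable]: "A \<in> sets M" using A H.subalg by (auto simp: subalgebra_def)
  have "prob (A \<inter> ?E) = (\<integral>\<omega>\<in>A. indicator ?E \<omega> \<partial>M)"
    by (simp add: set_lebesgue_integral_def flip: indicator_inter_arith)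
  also have "\<dots> = (\<integral>\<omega>\<in>A. real_cond_exp M (history_wait M W I n) (indicator ?E) \<omega> \<partial>M)"
    by (rule H.real_cond_exp_intA[OF integrable_real_indicator A]) (auto simp: emeasure_eq_measure)
  also have "\<dots> = (\<integral>\<omega>. indicator A \<omega> * \<pi> n k \<partial>M)"
    unfolding set_lebesgue_integral_def
    using type_cond[of n] k
    by (intro integral_cong_AE) (auto elim!: eventually_mono split: split_indicator)
  finally show 1: "prob (A \<inter> ?E) = \<pi> n k * prob A" by simp
  have "prob (A \<inter> {\<omega> \<in> space M. I n \<omega> \<noteq> 1}) = prob (A - A \<inter> ?E)"
    using sets.sets_into_space[OF AM] by (intro arg_cong[where f = prob]) auto
  also have "\<dots> = prob A - prob (A \<inter> ?E)"
    by (rule finite_measure_Diff) auto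
  finally show "prob (A \<inter> {\<omega> \<in> space M. I n \<omega> \<noteq> 1}) = (1 - \<pi> n k) * prob A"
    by (simp add: 1 algebra_simps)
qed

lemma K_history [measurable]: "K n \<in> history M W I n \<rightarrow>\<^sub>M count_space UNIV"
  by (rule measurable_type_count) (rule measurable_history)

lemma T_history [measurable]: "T n \<in> borel_measurable (history M W I n)"
  by (rule measurable_renewal_time) (rule measurable_history)

lemma K_history_wait [measurable]: "K n \<in> history_wait M W I n \<rightarrow>\<^sub>M count_space UNIV"
  by (rule measurable_type_count) (rule measurable_history_wait)

lemma T_history_wait [measurable]: "T (Suc n) \<in> borel_measurable (history_wait M W I n)"
  by (rule measurable_renewal_time) (auto simp: less_Suc_eq intro: measurable_history_wait)

lemma space_history [simp]: "space (history M W I n) = space M" "space (history_wait M W I n) = space M"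
  by (simp_all add: history_def history_wait_def)

lemma prob_count_Suc:
  assumes C: "C \<in> sets (history_wait M W I n)"
  shows "prob (C \<inter> {\<omega> \<in> space M. K (Suc n) \<omega> = 0}) =
      (1 - \<pi> n 0) * prob (C \<inter> {\<omega> \<in> space M. K n \<omega> = 0})"
    and "prob (C \<inter> {\<omega> \<in> space M. K (Suc n) \<omega> = Suc k}) =
      (1 - \<pi> n (Suc k)) * prob (C \<inter> {\<omega> \<in> space M. K n \<omega> = Suc k}) +
      \<pi> n k * prob (C \<inter> {\<omega> \<in> space M. K n \<omega> = k})"
proof -
  interpret H: finite_measure_subalgebra M "history_wait M W I n" by (rule history_wait_subalgebra)
  define A where "A j = C \<inter> {\<omega> \<in> space M. K n \<omega> = j}" for j
  have A: "A j \<in> sets (history_wait M W I n)" for j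
  proof -
    have "{\<omega> \<in> space (history_wait M W I n). K n \<omega> = j} \<in> sets (history_wait M W I n)" by measurable
    then show ?thesis unfolding A_def using C by auto
  qed
  then have AM [measurable]: "A j \<in> sets M" for j using H.subalg by (auto simp: subalgebra_def)
  have Ak: "A j \<subseteq> {\<omega>. K n \<omega> = j}" for j by (auto simp: A_def)
  have CM: "C \<subseteq> space M" using C sets.sets_into_space by fastforce
  have "C \<inter> {\<omega> \<in> space M. K (Suc n) \<omega> = 0} = A 0 \<inter> {\<omega> \<in> space M. I n \<omega> \<noteq> 1}"
    by (auto simp: A_def type_count_Suc)
  then show "prob (C \<inter> {\<omega> \<in> space M. K (Suc n) \<omega> = 0}) =
      (1 - \<pi> n 0) * prob (C \<inter> {\<omega> \<in> space M. K n \<omega> = 0})"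
    using prob_history_wait_type(2)[OF A Ak, of 0] by (simp add: A_def)
  have "C \<inter> {\<omega> \<in> space M. K (Suc n) \<omega> = Suc k} =
      A (Suc k) \<inter> {\<omega> \<in> space M. I n \<omega> \<noteq> 1} \<union> A k \<inter> {\<omega> \<in> space M. I n \<omega> = 1}"
    by (auto simp: A_def type_count_Suc split: if_splits)
  moreover have "prob (A (Suc k) \<inter> {\<omega> \<in> space M. I n \<omega> \<noteq> 1} \<union> A k \<inter> {\<omega> \<in> space M. I n \<omega> = 1}) =
      prob (A (Suc k) \<inter> {\<omega> \<in> space M. I n \<omega> \<noteq> 1}) + prob (A k \<inter> {\<omega> \<in> space M. I n \<omega> = 1})"
    by (rule finite_measure_Union) auto
  ultimately show "prob (C \<inter> {\<omega> \<in> space M. K (Suc n) \<omega> = Suc k}) =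
      (1 - \<pi> n (Suc k)) * prob (C \<inter> {\<omega> \<in> space M. K n \<omega> = Suc k}) +
      \<pi> n k * prob (C \<inter> {\<omega> \<in> space M. K n \<omega> = k})"
    using prob_history_wait_type[OF A Ak] by (simp add: A_def)
qed

definition count_prob :: "nat \<Rightarrow> nat \<Rightarrow> real" where
  "count_prob n k = prob {\<omega> \<in> space M. K n \<omega> = k}"

lemma count_prob_nonneg: "0 \<le> count_prob n k"
  by (simp add: count_prob_def)

lemma count_prob_le_1: "count_prob n k \<le> 1"
  by (simp add: count_prob_def)

lemma count_prob_0: "count_prob 0 k = of_bool (k = 0)"
  by (simp add: count_prob_def prob_space)

lemma count_prob_Suc:
  "count_prob (Suc n) 0 = (1 - \<pi> n 0) * count_prob n 0"
  "count_prob (Suc n) (Suc k) = (1 - \<pi> n (Suc k)) * count_prob n (Suc k) + \<pi> n k * count_prob n k"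
  using prob_count_Suc(1)[of "space M" n] prob_count_Suc(2)[of "space M" n k] sets.top[of "history_wait M W I n"]
  by (simp_all add: count_prob_def Int_absorb1)


text \<open>
  Drawing the type of the renewal redistributes probability between neighbouring type counts with
  factors that do not involve the renewal time, so the factorised joint law survives the draw.
\<close>

lemma joint_law_after_type:
  assumes IH: "\<And>k g. g \<in> borel_measurable borel \<Longrightarrow>
      (\<integral>\<^sup>+ \<omega>. indicator {\<omega> \<in> space M. K n \<omega> = k} \<omega> * g (T (Suc n) \<omega>) \<partial>M) =
      (\<integral>\<^sup>+ r. ennreal (count_prob n k * (rate n * birth_prob s \<delta> n r)) * indicator {0..} r * g r \<partial>lborel)"
    and g [measurable]: "g \<in> borel_measurable borel"
  shows "(\<integral>\<^sup>+ \<omega>. indicator {\<omega> \<in> space M. K (Suc n) \<omega> = k} \<omega> * g (T (Suc n) \<omega>) \<partial>M) =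
    (\<integral>\<^sup>+ r. ennreal (count_prob (Suc n) k * (rate n * birth_prob s \<delta> n r)) * indicator {0..} r * g r \<partial>lborel)"
proof -
  define h where "h r = ennreal (rate n * birth_prob s \<delta> n r) * indicator {0..} r" for r
  have [measurable]: "h \<in> borel_measurable borel" unfolding h_def[abs_def] by measurable
  define c where "c = ennreal (count_prob (Suc n) k)"
  have "(\<integral>\<^sup>+ \<omega>. indicator {\<omega> \<in> space M. K (Suc n) \<omega> = k} \<omega> * g (T (Suc n) \<omega>) \<partial>M) =
      (\<integral>\<^sup>+ r. c * h r * g r \<partial>lborel)"
  proof (rule nn_integral_density_on_event)
    fix B :: "real set" assume [measurable]: "B \<in> sets borel"
    define C where "C = {\<omega> \<in> space M. T (Suc n) \<omega> \<in> B}"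
    have C: "C \<in> sets (history_wait M W I n)"
    proof -
      have "{\<omega> \<in> space (history_wait M W I n). T (Suc n) \<omega> \<in> B} \<in> sets (history_wait M W I n)"
        by measurable
      then show ?thesis by (simp add: C_def)
    qed
    have [measurable]: "C \<in> sets M" by (simp add: C_def)
    define D where "D = (\<integral>\<^sup>+ r. h r * indicator B r \<partial>lborel)"
    have E: "ennreal (prob (C \<inter> {\<omega> \<in> space M. K n \<omega> = j})) = count_prob n j * D" for j
    proof -
      have "ennreal (prob (C \<inter> {\<omega> \<in> space M. K n \<omega> = j})) =
          (\<integral>\<^sup>+ \<omega>. indicator {\<omega> \<in> space M. K n \<omega> = j} \<omega> * indicator B (T (Suc n) \<omega>) \<partial>M)"
      proof -
        have "ennreal (prob (C \<inter> {\<omega> \<in> space M. K n \<omega> = j})) =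
            (\<integral>\<^sup>+ \<omega>. indicator (C \<inter> {\<omega> \<in> space M. K n \<omega> = j}) \<omega> \<partial>M)"
          by (simp add: emeasure_eq_measure)
        then show ?thesis
          by (simp only:, intro nn_integral_cong) (auto simp: C_def split: split_indicator)
      qed
      also have "\<dots> = (\<integral>\<^sup>+ r. count_prob n j * (h r * indicator B r) \<partial>lborel)"
        by (subst IH) (auto simp: h_def ennreal_mult'[OF count_prob_nonneg] mult.assoc)
      finally show ?thesis by (simp add: D_def nn_integral_cmult)
    qed
    \<comment> \<open>Finiteness of \<open>D\<close> is read off from a type count of positive probability; it allows the recursion to be applied in the reals, where the factors \<open>1 - \<pi> n k\<close> live.\<close>
    have "D < top"
    proof (rule ccontr)
      assume "\<not> D < top"
      then have D: "D = top" by (metis top.not_eq_extremum)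
      have "count_prob n j = 0" for j
      proof (rule ccontr)
        assume "count_prob n j \<noteq> 0"
        then have "ennreal (count_prob n j) * D = top"
          using count_prob_nonneg[of n j] by (simp add: D ennreal_mult_eq_top_iff)
        then show False using E[of j] by simp
      qed
      then have "AE \<omega> in M. K n \<omega> \<noteq> j" for j
        by (subst prob_Collect_eq_0[symmetric]) (auto simp: count_prob_def)
      then have "AE \<omega> in M. \<forall>j. K n \<omega> \<noteq> j" unfolding AE_all_countable by blast
      then have "AE \<omega> in M. False" by (rule eventually_mono) simp
      then show False by simp
    qed
    then obtain d where d: "0 \<le> d" "D = ennreal d" by (cases D) auto
    have Ed: "prob (C \<inter> {\<omega> \<in> space M. K n \<omega> = j}) = count_prob n j * d" for j
      using E[of j] d count_prob_nonneg[of n j] by (simp flip: ennreal_mult)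
    have "prob (C \<inter> {\<omega> \<in> space M. K (Suc n) \<omega> = k}) = count_prob (Suc n) k * d"
    proof (cases k)
      case 0
      then show ?thesis using prob_count_Suc(1)[OF C] by (simp add: count_prob_Suc Ed)
    next
      case (Suc j)
      then show ?thesis using prob_count_Suc(2)[OF C, of j] by (simp add: count_prob_Suc Ed algebra_simps)
    qed
    then have "emeasure M (C \<inter> {\<omega> \<in> space M. K (Suc n) \<omega> = k}) = c * D"
      by (simp add: emeasure_eq_measure c_def d ennreal_mult count_prob_nonneg)
    then show "emeasure M ({\<omega> \<in> space M. T (Suc n) \<omega> \<in> B} \<inter> {\<omega> \<in> space M. K (Suc n) \<omega> = k}) =
        (\<integral>\<^sup>+ r. c * h r * indicator B r \<partial>lborel)"
      by (simp add: C_def D_def mult.assoc nn_integral_cmult)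
  qed measurable
  then show ?thesis
    by (simp add: c_def h_def ennreal_mult'[OF count_prob_nonneg] mult.assoc)
qed

text \<open>
  At the time of the \<open>(n + 1)\<close>-st renewal, before its type is drawn, the renewal time is independent
  of the type count and has density \<open>rate n * birth_prob s \<delta> n\<close>.  The statement starts at the first
  renewal because \<open>T 0 = 0\<close> has no density.
\<close>

lemma joint_law_before_type:
  assumes g [measurable]: "g \<in> borel_measurable borel"
  shows "(\<integral>\<^sup>+ \<omega>. indicator {\<omega> \<in> space M. K n \<omega> = k} \<omega> * g (T (Suc n) \<omega>) \<partial>M) =
    (\<integral>\<^sup>+ r. ennreal (count_prob n k * (rate n * birth_prob s \<delta> n r)) * indicator {0..} r * g r \<partial>lborel)"
  using g
proof (induction n arbitrary: k g)
  case 0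
  note [measurable] = 0
  define f where "f p = indicator {k} (fst p) * g (snd p)" for p :: "nat \<times> real"
  have [measurable]: "f \<in> borel_measurable (count_space UNIV \<Otimes>\<^sub>M borel)"
    unfolding f_def[abs_def]
    by (intro borel_measurable_times_ennreal measurable_compose[OF measurable_snd 0]
        measurable_compose[OF measurable_fst]) auto
  have "(\<integral>\<^sup>+ \<omega>. indicator {\<omega> \<in> space M. K 0 \<omega> = k} \<omega> * g (T (Suc 0) \<omega>) \<partial>M) =
      (\<integral>\<^sup>+ \<omega>. f (K 0 \<omega>, W 0 \<omega>) \<partial>M)"
    by (intro nn_integral_cong) (simp add: f_def renewal_time_def indicator_def)
  also have "\<dots> = (\<integral>\<^sup>+ \<omega>. (\<integral>\<^sup>+ w. ennreal (exponential_density (rate 0) w) * f (K 0 \<omega>, w) \<partial>lborel) \<partial>M)"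
    by (rule nn_integral_history_wait[OF K_history]) measurable
  also have "\<dots> = (\<integral>\<^sup>+ w. ennreal (exponential_density (rate 0) w) * f (0, w) \<partial>lborel)"
    by (simp add: emeasure_space_1)
  also have "\<dots> = (\<integral>\<^sup>+ r. ennreal (count_prob 0 k * (rate 0 * birth_prob s \<delta> 0 r)) * indicator {0..} r * g r \<partial>lborel)"
    by (intro nn_integral_cong)
      (auto simp: f_def count_prob_0 birth_prob_def exponential_density_def indicator_def mult_ac)
  finally show ?case .
next
  case (Suc n)
  note [measurable] = Suc.prems
  let ?l = "rate (Suc n)"
  define h where "h r = ennreal (rate n * birth_prob s \<delta> n r) * indicator {0..} r" for r
  have [measurable]: "h \<in> borel_measurable borel" unfolding h_def[abs_def] by measurable
  define c where "c = ennreal (count_prob (Suc n) k)"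
  have law: "(\<integral>\<^sup>+ \<omega>. indicator {\<omega> \<in> space M. K (Suc n) \<omega> = k} \<omega> * g' (T (Suc n) \<omega>) \<partial>M) =
      (\<integral>\<^sup>+ r. c * h r * g' r \<partial>lborel)" if "g' \<in> borel_measurable borel" for g'
    using joint_law_after_type[OF Suc.IH that, of k]
    by (simp add: c_def h_def ennreal_mult'[OF count_prob_nonneg] mult.assoc)
  define G where "G r = (\<integral>\<^sup>+ w. ennreal (exponential_density ?l w) * g (r + w) \<partial>lborel)" for r
  have [measurable]: "G \<in> borel_measurable borel" unfolding G_def[abs_def] by measurable
  define f where "f p = (if fst (fst p) = k then g (snd (fst p) + snd p) else 0)" for p :: "(nat \<times> real) \<times> real"
  have "(\<lambda>p. snd (fst p) + snd p :: real) \<in> borel_measurable ((count_space UNIV \<Otimes>\<^sub>M borel) \<Otimes>\<^sub>M borel)"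
    by measurable
  note [measurable] = measurable_compose[OF this Suc.prems]
  have [measurable]: "f \<in> borel_measurable ((count_space UNIV \<Otimes>\<^sub>M borel) \<Otimes>\<^sub>M borel)"
    unfolding f_def[abs_def] by measurable
  have "(\<integral>\<^sup>+ \<omega>. indicator {\<omega> \<in> space M. K (Suc n) \<omega> = k} \<omega> * g (T (Suc (Suc n)) \<omega>) \<partial>M) =
      (\<integral>\<^sup>+ \<omega>. f ((K (Suc n) \<omega>, T (Suc n) \<omega>), W (Suc n) \<omega>) \<partial>M)"
    by (intro nn_integral_cong) (simp add: f_def renewal_time_Suc indicator_def)
  also have "\<dots> = (\<integral>\<^sup>+ \<omega>. (\<integral>\<^sup>+ w. ennreal (exponential_density ?l w) *
      f ((K (Suc n) \<omega>, T (Suc n) \<omega>), w) \<partial>lborel) \<partial>M)"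
    by (rule nn_integral_history_wait[OF measurable_Pair[OF K_history T_history]]) measurable
  also have "\<dots> = (\<integral>\<^sup>+ \<omega>. indicator {\<omega> \<in> space M. K (Suc n) \<omega> = k} \<omega> * G (T (Suc n) \<omega>) \<partial>M)"
    by (intro nn_integral_cong) (auto simp: f_def G_def indicator_def)
  also have "\<dots> = (\<integral>\<^sup>+ r. c * h r * G r \<partial>lborel)"
    by (rule law) measurable
  \<comment> \<open>The substitution \<open>v = r + w\<close> makes the new renewal time the outer variable after exchanging the integrals.\<close>
  also have "\<dots> = (\<integral>\<^sup>+ r. (\<integral>\<^sup>+ v. c * h r * (ennreal (exponential_density ?l (v - r)) * g v) \<partial>lborel) \<partial>lborel)"
  proof (intro nn_integral_cong)
    fix r :: real
    have "G r = (\<integral>\<^sup>+ v. ennreal (exponential_density ?l (v - r)) * g v \<partial>lborel)"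
      unfolding G_def
      by (subst nn_integral_real_affine[of "\<lambda>v. ennreal (exponential_density ?l (v - r)) * g v" 1 r]) auto
    then show "c * h r * G r = (\<integral>\<^sup>+ v. c * h r * (ennreal (exponential_density ?l (v - r)) * g v) \<partial>lborel)"
      by (simp add: nn_integral_cmult)
  qed
  also have "\<dots> = (\<integral>\<^sup>+ v. (\<integral>\<^sup>+ r. c * h r * (ennreal (exponential_density ?l (v - r)) * g v) \<partial>lborel) \<partial>lborel)"
    by (rule lborel_pair.Fubini') measurable
  also have "\<dots> = (\<integral>\<^sup>+ v. ennreal (count_prob (Suc n) k * (?l * birth_prob s \<delta> (Suc n) v)) * indicator {0..} v * g v \<partial>lborel)"
  proof (intro nn_integral_cong)
    fix v :: real
    have "(\<integral>\<^sup>+ r. h r * ennreal (exponential_density ?l (v - r)) \<partial>lborel) =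
        ennreal (?l * birth_prob s \<delta> (Suc n) v) * indicator {0..} v"
    proof (cases "0 \<le> v")
      case True
      have "(\<integral>\<^sup>+ r. h r * ennreal (exponential_density ?l (v - r)) \<partial>lborel) =
          (\<integral>\<^sup>+ r. ennreal ?l * (ennreal (rate n * birth_prob s \<delta> n r * exp (- ?l * (v - r)))
            * indicator {0..v} r) \<partial>lborel)"
      proof (intro nn_integral_cong)
        fix r :: real
        define x where "x = rate n * birth_prob s \<delta> n r"
        define e where "e = exp (- ?l * (v - r))"
        define l where "l = ?l"
        have "ennreal x * indicator {0..} r * ennreal (exponential_density l (v - r)) =
            ennreal l * (ennreal (x * e) * indicator {0..v} r)"
        proof (cases "0 \<le> r \<and> r \<le> v")
          case True
          then have "0 \<le> x"
            using s_pos \<delta>_pos rate_pos[of n] unfolding x_def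
            by (intro mult_nonneg_nonneg birth_prob_nonneg) auto
          moreover have "exponential_density l (v - r) = l * e"
            using True by (simp add: exponential_density_def e_def l_def algebra_simps)
          moreover have "0 \<le> l" "0 \<le> e" using rate_pos[of "Suc n"] by (simp_all add: l_def e_def)
          ultimately show ?thesis using True by (simp add: ennreal_mult mult_ac)
        qed (auto simp: exponential_density_def indicator_def)
        then show "h r * ennreal (exponential_density ?l (v - r)) =
            ennreal ?l * (ennreal (rate n * birth_prob s \<delta> n r * exp (- ?l * (v - r))) * indicator {0..v} r)"
          by (simp only: h_def x_def e_def l_def)
      qed
      also have "\<dots> = ennreal ?l * ennreal (birth_prob s \<delta> (Suc n) v)"
        by (subst nn_integral_cmult) (simp_all only: birth_prob_convolution[OF s_pos \<delta>_pos True], measurable)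
      finally show ?thesis
        using True rate_pos[of "Suc n"] birth_prob_nonneg[OF s_pos \<delta>_pos True]
        by (simp add: ennreal_mult del: of_nat_Suc)
    next
      case False
      then have "(\<lambda>r. h r * ennreal (exponential_density ?l (v - r))) = (\<lambda>_. 0)"
        by (auto simp: h_def exponential_density_def indicator_def fun_eq_iff)
      then show ?thesis using False by (simp only:) simp
    qed
    moreover have "(\<integral>\<^sup>+ r. c * h r * (ennreal (exponential_density ?l (v - r)) * g v) \<partial>lborel) =
        c * g v * (\<integral>\<^sup>+ r. h r * ennreal (exponential_density ?l (v - r)) \<partial>lborel)"
      by (subst nn_integral_cmult[symmetric]) (auto intro!: nn_integral_cong simp: mult_ac)
    ultimately show "(\<integral>\<^sup>+ r. c * h r * (ennreal (exponential_density ?l (v - r)) * g v) \<partial>lborel) =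
        ennreal (count_prob (Suc n) k * (?l * birth_prob s \<delta> (Suc n) v)) * indicator {0..} v * g v"
      unfolding c_def ennreal_mult'[OF count_prob_nonneg] by (simp only: mult_ac)
  qed
  finally show ?case .
qed

lemma joint_law_at_renewal:
  assumes "g \<in> borel_measurable borel"
  shows "(\<integral>\<^sup>+ \<omega>. indicator {\<omega> \<in> space M. K (Suc n) \<omega> = k} \<omega> * g (T (Suc n) \<omega>) \<partial>M) =
    (\<integral>\<^sup>+ r. ennreal (count_prob (Suc n) k * (rate n * birth_prob s \<delta> n r)) * indicator {0..} r * g r \<partial>lborel)"
  by (rule joint_law_after_type[OF joint_law_before_type assms])

text \<open>
  At time \<open>t\<close> exactly \<open>n\<close> renewals have happened if the \<open>n\<close>-th came at some \<open>r \<le> t\<close> and the waiting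
  time for the next exceeds \<open>t - r\<close>; integrating over \<open>r\<close> is the integrated forward equation.
\<close>

lemma prob_occupation:
  assumes t: "0 \<le> t"
  shows "prob {\<omega> \<in> space M. (T n \<omega> \<le> t \<and> t < T (Suc n) \<omega>) \<and> K n \<omega> = k} = count_prob n k * birth_prob s \<delta> n t"
proof (cases n)
  case 0
  have "{\<omega> \<in> space M. K 0 \<omega> = k} \<in> sets (history M W I 0)"
    using sets.top[of "history M W I 0"] by simp
  from prob_history_wait[OF this t]
  have "prob ({\<omega> \<in> space M. K 0 \<omega> = k} \<inter> {\<omega> \<in> space M. t < W 0 \<omega>}) = count_prob 0 k * exp (- s * t)"
    by (simp add: count_prob_def)
  moreover have "{\<omega> \<in> space M. (T 0 \<omega> \<le> t \<and> t < T (Suc 0) \<omega>) \<and> K 0 \<omega> = k}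
      = {\<omega> \<in> space M. K 0 \<omega> = k} \<inter> {\<omega> \<in> space M. t < W 0 \<omega>}"
    using t by (auto simp: renewal_time_def)
  ultimately show ?thesis by (simp add: 0 birth_prob_def)
next
  case (Suc m)
  let ?l = "rate n"
  define f :: "(nat \<times> real) \<times> real \<Rightarrow> ennreal" where
    "f p = (if fst (fst p) = k \<and> snd (fst p) \<le> t \<and> t < snd (fst p) + snd p then 1 else 0)" for p
  have [measurable]: "f \<in> borel_measurable ((count_space UNIV \<Otimes>\<^sub>M borel) \<Otimes>\<^sub>M borel)"
    unfolding f_def[abs_def] by measurable
  define g where "g r = indicator {..t} r * ennreal (exp (- ?l * (t - r)))" for r
  have g: "g \<in> borel_measurable borel" unfolding g_def[abs_def] by measurable
  let ?E = "{\<omega> \<in> space M. (T n \<omega> \<le> t \<and> t < T (Suc n) \<omega>) \<and> K n \<omega> = k}"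
  have "ennreal (prob ?E) = (\<integral>\<^sup>+ \<omega>. indicator ?E \<omega> \<partial>M)"
    by (simp add: emeasure_eq_measure)
  also have "\<dots> = (\<integral>\<^sup>+ \<omega>. f ((K n \<omega>, T n \<omega>), W n \<omega>) \<partial>M)"
    by (intro nn_integral_cong) (auto simp: f_def renewal_time_Suc indicator_def)
  also have "\<dots> = (\<integral>\<^sup>+ \<omega>. (\<integral>\<^sup>+ w. ennreal (exponential_density ?l w) * f ((K n \<omega>, T n \<omega>), w) \<partial>lborel) \<partial>M)"
    by (rule nn_integral_history_wait[OF measurable_Pair[OF K_history T_history]]) measurable
  also have "\<dots> = (\<integral>\<^sup>+ \<omega>. indicator {\<omega> \<in> space M. K n \<omega> = k} \<omega> * g (T n \<omega>) \<partial>M)"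
  proof (intro nn_integral_cong)
    fix \<omega> assume \<omega>: "\<omega> \<in> space M"
    show "(\<integral>\<^sup>+ w. ennreal (exponential_density ?l w) * f ((K n \<omega>, T n \<omega>), w) \<partial>lborel) =
        indicator {\<omega> \<in> space M. K n \<omega> = k} \<omega> * g (T n \<omega>)"
    proof (cases "K n \<omega> = k \<and> T n \<omega> \<le> t")
      case True
      then have "f ((K n \<omega>, T n \<omega>), w) = indicator {t - T n \<omega> <..} w" for w
        by (auto simp: f_def indicator_def)
      then show ?thesis
        using True \<omega> exponential_tail[OF rate_pos, of "t - T n \<omega>" n] by (simp add: g_def)
    next
      case False
      then have "f ((K n \<omega>, T n \<omega>), w) = 0" for w by (auto simp: f_def)
      then show ?thesis using False by (auto simp: g_def)
    qed
  qed
  also have "\<dots> = (\<integral>\<^sup>+ r. ennreal (count_prob n k * (rate m * birth_prob s \<delta> m r)) * indicator {0..} r * g r \<partial>lborel)"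
    using joint_law_at_renewal[OF g, of m k] by (simp only: Suc)
  also have "\<dots> = (\<integral>\<^sup>+ r. ennreal (count_prob n k) *
      (ennreal (rate m * birth_prob s \<delta> m r * exp (- ?l * (t - r))) * indicator {0..t} r) \<partial>lborel)"
  proof (intro nn_integral_cong)
    fix r :: real
    have e: "ennreal (rate m * birth_prob s \<delta> m r * exp (- ?l * (t - r))) =
        ennreal (rate m * birth_prob s \<delta> m r) * ennreal (exp (- ?l * (t - r)))"
      by (rule ennreal_mult'') simp
    show "ennreal (count_prob n k * (rate m * birth_prob s \<delta> m r)) * indicator {0..} r * g r =
        ennreal (count_prob n k) *
        (ennreal (rate m * birth_prob s \<delta> m r * exp (- ?l * (t - r))) * indicator {0..t} r)"
      unfolding ennreal_mult'[OF count_prob_nonneg] e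
      by (cases "0 \<le> r"; cases "r \<le> t") (simp_all add: g_def mult.assoc)
  qed
  also have "\<dots> = ennreal (count_prob n k) * ennreal (birth_prob s \<delta> n t)"
    unfolding Suc by (subst nn_integral_cmult) (simp_all only: birth_prob_convolution[OF s_pos \<delta>_pos t], measurable)
  finally show ?thesis
    using count_prob_nonneg[of n k] birth_prob_nonneg[OF s_pos \<delta>_pos t, of n]
    by (simp flip: ennreal_mult)
qed

lemma AE_W_pos: "AE \<omega> in M. \<forall>n. 0 < W n \<omega>"
proof -
  have "AE \<omega> in M. 0 < W n \<omega>" for n
  proof -
    have "prob {\<omega> \<in> space M. 0 < W n \<omega>} = 1"
      using prob_history_wait[of "space M" n 0] sets.top[of "history M W I n"]
      by (simp add: prob_space Int_absorb1)
    then show ?thesis by (subst (asm) prob_Collect_eq_1) auto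
  qed
  then show ?thesis by (simp add: AE_all_countable)
qed

lemma occupation_index_unique:
  assumes W: "\<forall>n. 0 < W n \<omega>"
    and m: "T m \<omega> \<le> t" "t < T (Suc m) \<omega>" and n: "T n \<omega> \<le> t" "t < T (Suc n) \<omega>"
  shows "m = n"
proof -
  have mono: "T i \<omega> \<le> T j \<omega>" if "i \<le> j" for i j
    using that by (rule lift_Suc_mono_le[rotated]) (use W in \<open>auto simp: renewal_time_Suc less_imp_le\<close>)
  show ?thesis
    using m n mono[of "Suc m" n] mono[of "Suc n" m] by (cases m n rule: linorder_cases) auto
qed

lemma prob_number_of_renewals:
  assumes t: "0 \<le> t"
  shows "prob {\<omega> \<in> space M. T n \<omega> \<le> t \<and> t < T (Suc n) \<omega>} = birth_prob s \<delta> n t"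
proof -
  have "(\<lambda>k. count_prob n k) sums prob {\<omega> \<in> space M. True}"
    unfolding count_prob_def by (rule prob_sums) auto
  then have "(\<lambda>k. count_prob n k * birth_prob s \<delta> n t) sums (1 * birth_prob s \<delta> n t)"
    by (intro sums_mult2) (simp add: prob_space)
  moreover have "(\<lambda>k. count_prob n k * birth_prob s \<delta> n t) sums
      prob {\<omega> \<in> space M. T n \<omega> \<le> t \<and> t < T (Suc n) \<omega>}"
    unfolding prob_occupation[OF t, symmetric] by (rule prob_sums) auto
  ultimately show ?thesis by (simp add: sums_unique2)
qed

text \<open>
  The probabilities of having exactly \<open>n\<close> renewals by time \<open>t\<close> add up to 1, which leaves no mass for
  infinitely many.
\<close>

lemma AE_not_exploded:
  assumes t: "0 \<le> t"
  shows "AE \<omega> in M. \<exists>n. T n \<omega> \<le> t \<and> t < T (Suc n) \<omega>"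
proof -
  have "(\<lambda>n. birth_prob s \<delta> n t) sums prob {\<omega> \<in> space M. \<exists>n. T n \<omega> \<le> t \<and> t < T (Suc n) \<omega>}"
    unfolding prob_number_of_renewals[OF t, symmetric]
  proof (rule prob_sums)
    show "AE \<omega> in M. (\<forall>n. T n \<omega> \<le> t \<and> t < T (Suc n) \<omega> \<longrightarrow> (\<exists>n. T n \<omega> \<le> t \<and> t < T (Suc n) \<omega>)) \<and>
        ((\<exists>n. T n \<omega> \<le> t \<and> t < T (Suc n) \<omega>) \<longrightarrow> (\<exists>!n. T n \<omega> \<le> t \<and> t < T (Suc n) \<omega>))"
      using AE_W_pos by (rule eventually_mono) (metis occupation_index_unique)
  qed measurable
  with birth_prob_sums[OF \<delta>_pos t, of s]
  have "prob {\<omega> \<in> space M. \<exists>n. T n \<omega> \<le> t \<and> t < T (Suc n) \<omega>} = 1"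
    by (rule sums_unique2[symmetric])
  then show ?thesis by (subst (asm) prob_Collect_eq_1) auto
qed

lemma nn_integral_at_time:
  fixes \<phi> :: "nat \<Rightarrow> nat \<Rightarrow> ennreal" and F :: "'a \<Rightarrow> ennreal"
  assumes t: "0 \<le> t"
    and F: "AE \<omega> in M. \<forall>n. T n \<omega> \<le> t \<and> t < T (Suc n) \<omega> \<longrightarrow> F \<omega> = \<phi> n (K n \<omega>)"
  shows "(\<integral>\<^sup>+ \<omega>. F \<omega> \<partial>M) = (\<Sum>n. \<Sum>k. \<phi> n k * ennreal (count_prob n k * birth_prob s \<delta> n t))"
proof -
  define E where "E n k = {\<omega> \<in> space M. (T n \<omega> \<le> t \<and> t < T (Suc n) \<omega>) \<and> K n \<omega> = k}" for n k
  have [measurable]: "E n k \<in> sets M" for n k unfolding E_def by measurable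
  have "AE \<omega> in M. F \<omega> = (\<Sum>n. \<Sum>k. \<phi> n k * indicator (E n k) \<omega>)"
    using F AE_W_pos AE_not_exploded[OF t] AE_space
  proof eventually_elim
    case (elim \<omega>)
    then obtain n where n: "T n \<omega> \<le> t" "t < T (Suc n) \<omega>" by blast
    have E: "\<omega> \<in> E m k \<longleftrightarrow> m = n \<and> k = K n \<omega>" for m k
      using elim n occupation_index_unique[OF elim(2), of m t n] by (auto simp: E_def)
    have "(\<Sum>m. \<Sum>k. \<phi> m k * indicator (E m k) \<omega>) = (\<Sum>m\<in>{n}. \<Sum>k. \<phi> m k * indicator (E m k) \<omega>)"
      by (rule suminf_finite) (auto simp: indicator_def E)
    also have "\<dots> = (\<Sum>k\<in>{K n \<omega>}. \<phi> n k * indicator (E n k) \<omega>)"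
      by (simp, subst suminf_finite[of "{K n \<omega>}"]) (auto simp: indicator_def E)
    finally show ?case using elim n E by simp
  qed
  then have "(\<integral>\<^sup>+ \<omega>. F \<omega> \<partial>M) = (\<integral>\<^sup>+ \<omega>. (\<Sum>n. \<Sum>k. \<phi> n k * indicator (E n k) \<omega>) \<partial>M)"
    by (rule nn_integral_cong_AE)
  also have "\<dots> = (\<Sum>n. \<Sum>k. \<phi> n k * emeasure M (E n k))"
    by (simp add: nn_integral_suminf nn_integral_cmult)
  also have "\<dots> = (\<Sum>n. \<Sum>k. \<phi> n k * ennreal (count_prob n k * birth_prob s \<delta> n t))"
    unfolding E_def emeasure_eq_measure prob_occupation[OF t] ..
  finally show ?thesis .
qed

end

section \<open>The walk with the triangular matrix\<close>

text \<open>
  The two forms agree because \<open>e\<^sup>-\<^sup>\<delta>\<^sup>v - 1 + e\<^sup>-\<^sup>\<delta>\<^sup>t = e\<^sup>-\<^sup>\<delta>\<^sup>v (1 - z)\<close>; the exponentials can be pulled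
  out of the real powers because the bounds on \<open>z\<close> and \<open>q\<close> keep both bases positive.
\<close>

lemma mgf_closed_form:
  fixes \<alpha> \<delta> x y t u v :: real
  assumes \<alpha>: "0 < \<alpha>" and \<delta>: "0 < \<delta>"
  defines "z \<equiv> (1 - exp (- \<delta> * t)) * exp (\<delta> * v)" and "q \<equiv> exp (\<alpha> * (u - v))"
  assumes z: "z < 1" and q: "q * (1 - (1 - z) powr (\<alpha> / \<delta>)) < 1"
  shows "exp (- (x + y) * t) * exp (u * x + v * y) *
      ((1 - q * (1 - (1 - z) powr (\<alpha> / \<delta>))) powr (- x / \<alpha>) * (1 - z) powr (- y / \<delta>)) =
    exp (- x * t) *
    (exp (- \<alpha> * u) - exp (- \<alpha> * v) + (exp (- \<delta> * v) - 1 + exp (- \<delta> * t)) powr (\<alpha> / \<delta>)) powr (- x / \<alpha>) *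
    (exp (- y * t) * (exp (- \<delta> * v) - 1 + exp (- \<delta> * t)) powr (- y / \<delta>))"
proof -
  have base: "exp (- \<delta> * v) - 1 + exp (- \<delta> * t) = exp (- \<delta> * v) * (1 - z)"
    by (simp add: z_def algebra_simps flip: exp_add)
  have base_powr: "(exp (- \<delta> * v) - 1 + exp (- \<delta> * t)) powr a = exp (- \<delta> * v * a) * (1 - z) powr a" for a
    using z unfolding base by (simp add: powr_mult exp_powr_real)
  have "exp (- \<alpha> * u) - exp (- \<alpha> * v) + (exp (- \<delta> * v) - 1 + exp (- \<delta> * t)) powr (\<alpha> / \<delta>) =
      exp (- \<alpha> * u) * (1 - q * (1 - (1 - z) powr (\<alpha> / \<delta>)))"
  proof -
    have "exp (- \<delta> * v * (\<alpha> / \<delta>)) = exp (- \<alpha> * v)" using \<delta> by simp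
    moreover have "exp (- \<alpha> * u) * q = exp (- \<alpha> * v)"
      by (simp add: q_def algebra_simps flip: exp_add)
    ultimately show ?thesis unfolding base_powr by (simp add: algebra_simps)
  qed
  then have "(exp (- \<alpha> * u) - exp (- \<alpha> * v) + (exp (- \<delta> * v) - 1 + exp (- \<delta> * t)) powr (\<alpha> / \<delta>)) powr (- x / \<alpha>) =
      exp (u * x) * (1 - q * (1 - (1 - z) powr (\<alpha> / \<delta>))) powr (- x / \<alpha>)"
    using q \<alpha> by (simp add: powr_mult exp_powr_real)
  moreover have "(exp (- \<delta> * v) - 1 + exp (- \<delta> * t)) powr (- y / \<delta>) = exp (v * y) * (1 - z) powr (- y / \<delta>)"
    unfolding base_powr using \<delta> by simp
  moreover have "exp (- (x + y) * t) * exp (u * x + v * y) = exp (- x * t) * exp (u * x) * (exp (- y * t) * exp (v * y))"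
    by (simp add: algebra_simps flip: exp_add)
  ultimately show ?thesis by simp
qed

lemma triangular_position:
  fixes x\<^sub>0 :: "real^2" and \<alpha> \<delta> :: real
  defines "A \<equiv> vector [vector [\<alpha>, \<delta> - \<alpha>], vector [0, \<delta>]] :: real^2^2"
  shows "renewal_position A x\<^sub>0 I n \<omega> $ 1 = x\<^sub>0 $ 1 + \<alpha> * type_count I n \<omega>"
    and "renewal_position A x\<^sub>0 I n \<omega> $ 2 = x\<^sub>0 $ 2 + \<delta> * n - \<alpha> * type_count I n \<omega>"
proof -
  have row: "A $ i $ 1 = (if i = 1 then \<alpha> else 0)" "A $ i $ 2 = (if i = 1 then \<delta> - \<alpha> else \<delta>)" for i
    using exhaust_2[of i] by (auto simp: A_def)
  show "renewal_position A x\<^sub>0 I n \<omega> $ 1 = x\<^sub>0 $ 1 + \<alpha> * type_count I n \<omega>"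
    by (induction n) (simp_all add: renewal_position_def type_count_Suc row algebra_simps)
  show "renewal_position A x\<^sub>0 I n \<omega> $ 2 = x\<^sub>0 $ 2 + \<delta> * n - \<alpha> * type_count I n \<omega>"
    by (induction n) (simp_all add: renewal_position_def type_count_Suc row algebra_simps)
qed

locale triangular_renewals = balanced_renewals M W I "x + y" \<delta> "\<lambda>n k. (x + \<alpha> * k) / (x + y + \<delta> * n)"
  for M :: "'a measure" and W I and x y \<alpha> \<delta> :: real +
  assumes \<alpha>_pos: "0 < \<alpha>" and x_nonneg: "0 \<le> x"
begin

text \<open>
  The rising factorial absorbs the denominators of the drawing probabilities: in the step from \<open>n\<close>
  to \<open>n + 1\<close> it contributes the factor \<open>rate n / (\<delta> (n + 1))\<close>.
\<close>

definition weight :: "nat \<Rightarrow> nat \<Rightarrow> real" where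
  "weight n k = pochhammer ((x + y) / \<delta>) n / fact n * count_prob n k"

lemma weight_Suc:
  fixes n k :: nat
  shows "\<delta> * (real n + 1) * weight (Suc n) 0 = (y + \<delta> * n) * weight n 0"
    and "\<delta> * (real n + 1) * weight (Suc n) (Suc k) =
     (y + \<delta> * n - \<alpha> * (real k + 1)) * weight n (Suc k) + (x + \<alpha> * k) * weight n k"
proof -
  define c where "c = pochhammer ((x + y) / \<delta>) n / fact n"
  have "(real n + 1) * (pochhammer ((x + y) / \<delta>) (Suc n) / fact (Suc n)) = ((x + y) / \<delta> + n) * c"
    by (simp add: c_def pochhammer_Suc add.commute[of _ 1])
  moreover have "\<delta> * ((x + y) / \<delta> + n) = rate n" using \<delta>_pos by (simp add: distrib_left[of \<delta> "(x + y) / \<delta>"])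
  ultimately have c: "\<delta> * (real n + 1) * (pochhammer ((x + y) / \<delta>) (Suc n) / fact (Suc n)) = rate n * c"
    by (metis mult.assoc)
  have *: "\<delta> * (real n + 1) * weight (Suc n) k = rate n * c * count_prob (Suc n) k" for k
    unfolding weight_def c[symmetric] by simp
  have w: "weight n j = c * count_prob n j" for j
    by (simp add: weight_def c_def)
  have nz: "x + y + \<delta> * real n \<noteq> 0" using rate_pos[of n] by simp
  have \<pi>': "rate n * ((x + \<alpha> * k) / rate n) = x + \<alpha> * k" for k :: nat
    using nz by simp
  have \<pi>: "rate n * (1 - (x + \<alpha> * k) / rate n) = y + \<delta> * n - \<alpha> * k" for k :: nat
    unfolding right_diff_distrib[of "rate n"] \<pi>' by simp
  have "\<delta> * (real n + 1) * weight (Suc n) 0 = c * (rate n * (1 - (x + \<alpha> * (0::nat)) / rate n)) * count_prob n 0"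
    unfolding * count_prob_Suc by (simp only: mult_ac)
  then show "\<delta> * (real n + 1) * weight (Suc n) 0 = (y + \<delta> * n) * weight n 0"
    unfolding \<pi> w by (simp add: mult_ac)
  have "\<delta> * (real n + 1) * weight (Suc n) (Suc k) =
      c * (rate n * (1 - (x + \<alpha> * Suc k) / rate n)) * count_prob n (Suc k) +
      c * (rate n * ((x + \<alpha> * k) / rate n)) * count_prob n k"
    unfolding * count_prob_Suc distrib_left[of "rate n * c"] by (simp only: mult_ac)
  then show "\<delta> * (real n + 1) * weight (Suc n) (Suc k) =
      (y + \<delta> * n - \<alpha> * (real k + 1)) * weight n (Suc k) + (x + \<alpha> * k) * weight n k"
    unfolding \<pi> \<pi>' w by (simp only: of_nat_Suc add.commute[of 1] mult_ac)
qed

lemma weight_double_series: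
  assumes z: "0 \<le> z" "z < 1" and q: "0 \<le> q" "q * (1 - (1 - z) powr (\<alpha> / \<delta>)) < 1"
  shows "(\<Sum>n. \<Sum>k. ennreal (weight n k * z ^ n * q ^ k)) =
    ennreal ((1 - q * (1 - (1 - z) powr (\<alpha> / \<delta>))) powr (- x / \<alpha>) * (1 - z) powr (- y / \<delta>))"
proof (rule occupation_double_series[OF \<alpha>_pos \<delta>_pos x_nonneg _ weight_Suc])
  show "weight 0 k = of_bool (k = 0)" for k by (simp add: weight_def count_prob_0)
  fix n k
  have "0 \<le> pochhammer ((x + y) / \<delta>) n"
    using s_pos \<delta>_pos by (simp add: pochhammer_prod prod_nonneg)
  then show "0 \<le> weight n k" "weight n k \<le> pochhammer ((x + y) / \<delta>) n / fact n"
    using count_prob_nonneg[of n k] count_prob_le_1[of n k]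
    by (auto simp: weight_def intro!: divide_right_mono mult_left_le)
qed (use z q in auto)

lemma nn_integral_mgf:
  fixes Z :: "'a \<Rightarrow> real^2" and u v t :: real
  assumes t: "0 \<le> t"
    and Z: "AE \<omega> in M. \<forall>n. T n \<omega> \<le> t \<and> t < T (Suc n) \<omega> \<longrightarrow>
      Z \<omega> $ 1 = x + \<alpha> * K n \<omega> \<and> Z \<omega> $ 2 = y + \<delta> * n - \<alpha> * K n \<omega>"
  defines "z \<equiv> (1 - exp (- \<delta> * t)) * exp (\<delta> * v)" and "q \<equiv> exp (\<alpha> * (u - v))"
  assumes z: "z < 1" and q: "q * (1 - (1 - z) powr (\<alpha> / \<delta>)) < 1"
  shows "(\<integral>\<^sup>+ \<omega>. ennreal (exp (u * Z \<omega> $ 1 + v * Z \<omega> $ 2)) \<partial>M) =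
    ennreal (exp (- x * t) *
    (exp (- \<alpha> * u) - exp (- \<alpha> * v) + (exp (- \<delta> * v) - 1 + exp (- \<delta> * t)) powr (\<alpha> / \<delta>)) powr (- x / \<alpha>) *
    (exp (- y * t) * (exp (- \<delta> * v) - 1 + exp (- \<delta> * t)) powr (- y / \<delta>)))"
proof -
  define \<phi> where "\<phi> n k = exp (u * (x + \<alpha> * k) + v * (y + \<delta> * n - \<alpha> * k))" for n k :: nat
  define C where "C = exp (- (x + y) * t) * exp (u * x + v * y)"
  have "AE \<omega> in M. \<forall>n. T n \<omega> \<le> t \<and> t < T (Suc n) \<omega> \<longrightarrow>
      ennreal (exp (u * Z \<omega> $ 1 + v * Z \<omega> $ 2)) = ennreal (\<phi> n (K n \<omega>))"
    using Z by (rule eventually_mono) (auto simp: \<phi>_def)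
  then have "(\<integral>\<^sup>+ \<omega>. ennreal (exp (u * Z \<omega> $ 1 + v * Z \<omega> $ 2)) \<partial>M) =
      (\<Sum>n. \<Sum>k. ennreal (\<phi> n k) * ennreal (count_prob n k * birth_prob (x + y) \<delta> n t))"
    by (rule nn_integral_at_time[OF t])
  also have "\<dots> = (\<Sum>n. \<Sum>k. ennreal C * ennreal (weight n k * z ^ n * q ^ k))"
  proof (intro suminf_cong)
    fix n k
    have "\<phi> n k = exp (u * x + v * y) * exp (\<delta> * v) ^ n * q ^ k"
      by (simp add: \<phi>_def q_def algebra_simps flip: exp_add exp_of_nat_mult)
    then have "\<phi> n k * (count_prob n k * birth_prob (x + y) \<delta> n t) = C * (weight n k * z ^ n * q ^ k)"
      by (simp add: birth_prob_def weight_def C_def z_def power_mult_distrib mult_ac)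
    moreover have "0 \<le> \<phi> n k" "0 \<le> C" by (simp_all add: \<phi>_def C_def)
    ultimately show "ennreal (\<phi> n k) * ennreal (count_prob n k * birth_prob (x + y) \<delta> n t) =
        ennreal C * ennreal (weight n k * z ^ n * q ^ k)"
      by (metis ennreal_mult')
  qed
  also have "\<dots> = ennreal C * (\<Sum>n. \<Sum>k. ennreal (weight n k * z ^ n * q ^ k))"
    by simp
  also have "\<dots> = ennreal (C *
      ((1 - q * (1 - (1 - z) powr (\<alpha> / \<delta>))) powr (- x / \<alpha>) * (1 - z) powr (- y / \<delta>)))"
  proof -
    have "0 \<le> z" "0 \<le> q" using t \<delta>_pos by (simp_all add: z_def q_def)
    moreover have "0 \<le> C" by (simp add: C_def)
    ultimately show ?thesis using z q by (simp add: weight_double_series ennreal_mult')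
  qed
  also have "C * ((1 - q * (1 - (1 - z) powr (\<alpha> / \<delta>))) powr (- x / \<alpha>) * (1 - z) powr (- y / \<delta>)) =
    exp (- x * t) *
    (exp (- \<alpha> * u) - exp (- \<alpha> * v) + (exp (- \<delta> * v) - 1 + exp (- \<delta> * t)) powr (\<alpha> / \<delta>)) powr (- x / \<alpha>) *
    (exp (- y * t) * (exp (- \<delta> * v) - 1 + exp (- \<delta> * t)) powr (- y / \<delta>))"
    unfolding C_def z_def q_def
    by (rule mgf_closed_form[OF \<alpha>_pos \<delta>_pos]) (use z q in \<open>simp_all add: z_def q_def\<close>)
  finally show ?thesis .
qed

end

text \<open>
  At the origin the two quantities are \<open>1 - e\<^sup>-\<^sup>\<delta>\<^sup>t\<close> and \<open>1 - e\<^sup>-\<^sup>\<alpha>\<^sup>t\<close>, both below 1, and they depend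
  continuously on \<open>(u, v)\<close>.
\<close>

lemma eventually_mgf_domain:
  fixes \<alpha> \<delta> t :: real
  assumes "0 < \<alpha>" "0 < \<delta>" "0 \<le> t"
  shows "\<forall>\<^sub>F p in nhds (0, 0).
    (1 - exp (- \<delta> * t)) * exp (\<delta> * snd p) < 1 \<and>
    exp (\<alpha> * (fst p - snd p)) * (1 - (1 - (1 - exp (- \<delta> * t)) * exp (\<delta> * snd p)) powr (\<alpha> / \<delta>)) < 1"
proof (rule eventually_conj)
  let ?N = "nhds (0 :: real, 0 :: real)"
  have fst: "(fst \<longlongrightarrow> 0) ?N" and snd: "(snd \<longlongrightarrow> 0) ?N"
    using tendsto_fst[OF filterlim_ident, of "(0 :: real, 0 :: real)"]
      tendsto_snd[OF filterlim_ident, of "(0 :: real, 0 :: real)"] by simp_all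
  have z: "((\<lambda>p. (1 - exp (- \<delta> * t)) * exp (\<delta> * snd p)) \<longlongrightarrow> (1 - exp (- \<delta> * t)) * exp (\<delta> * 0)) ?N"
    by (intro tendsto_intros snd)
  then show "\<forall>\<^sub>F p in ?N. (1 - exp (- \<delta> * t)) * exp (\<delta> * snd p) < 1"
    by (rule order_tendstoD) simp
  have "((\<lambda>p. exp (\<alpha> * (fst p - snd p)) * (1 - (1 - (1 - exp (- \<delta> * t)) * exp (\<delta> * snd p)) powr (\<alpha> / \<delta>)))
      \<longlongrightarrow> exp (\<alpha> * (0 - 0)) * (1 - (1 - (1 - exp (- \<delta> * t)) * exp (\<delta> * 0)) powr (\<alpha> / \<delta>))) ?N"
    by (intro tendsto_intros fst snd z) auto
  then show "\<forall>\<^sub>F p in ?N. exp (\<alpha> * (fst p - snd p)) *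
      (1 - (1 - (1 - exp (- \<delta> * t)) * exp (\<delta> * snd p)) powr (\<alpha> / \<delta>)) < 1"
    by (rule order_tendstoD) simp
qed

theorem theorem5p1:
  fixes \<alpha> \<delta> :: real
    and M :: "'a measure"
    and x\<^sub>0 :: "real^2"
    and X :: "real \<Rightarrow> 'a \<Rightarrow> real^2"
  assumes "0 < \<alpha>" and "\<alpha> < \<delta>"
    and "x\<^sub>0 $ 1 \<ge> 0" and "x\<^sub>0 $ 2 \<ge> 0" and "x\<^sub>0 $ 1 \<noteq> 0 \<or> x\<^sub>0 $ 2 \<noteq> 0"
    and "polya_walk M (vector [vector [\<alpha>, \<delta> - \<alpha>], vector [0, \<delta>]]) x\<^sub>0 X"
  shows "\<forall>t\<ge>0. \<forall>\<^sub>F (u, v) in nhds (0, 0).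
           integrable M (\<lambda>\<omega>. exp (u * X t \<omega> $ 1 + v * X t \<omega> $ 2)) \<and>
           (LINT \<omega>|M. exp (u * X t \<omega> $ 1 + v * X t \<omega> $ 2)) =
             exp (- (x\<^sub>0 $ 1) * t) *
             (exp (- \<alpha> * u) - exp (- \<alpha> * v)
               + (exp (- \<delta> * v) - 1 + exp (- \<delta> * t)) powr (\<alpha> / \<delta>)) powr (- (x\<^sub>0 $ 1) / \<alpha>) *
             (exp (- (x\<^sub>0 $ 2) * t) *
              (exp (- \<delta> * v) - 1 + exp (- \<delta> * t)) powr (- (x\<^sub>0 $ 2) / \<delta>))"
proof (intro allI impI)
  fix t :: real assume t: "0 \<le> t"
  have \<delta>: "0 < \<delta>" using assms(1,2) by simp
  define A where "A = (vector [vector [\<alpha>, \<delta> - \<alpha>], vector [0, \<delta>]] :: real^2^2)"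
  note pos = triangular_position[of \<alpha> \<delta>, folded A_def]
  from assms(6)[folded A_def, unfolded polya_walk_def] obtain W I where
    M: "prob_space M" and X: "\<forall>t\<ge>0. X t \<in> borel_measurable M"
    and W: "\<forall>n. W n \<in> borel_measurable M"
    and I: "\<forall>n. I n \<in> measurable M (count_space UNIV)"
    and wait: "\<forall>n. \<forall>s\<ge>0. AE \<omega> in M. real_cond_exp M (history M W I n)
        (indicator {\<omega> \<in> space M. W n \<omega> > s}) \<omega> =
        exp (- (renewal_position A x\<^sub>0 I n \<omega> $ 1 + renewal_position A x\<^sub>0 I n \<omega> $ 2) * s)"
    and type: "\<forall>n i. AE \<omega> in M. real_cond_exp M (history_wait M W I n)
        (indicator {\<omega> \<in> space M. I n \<omega> = i}) \<omega> = renewal_position A x\<^sub>0 I n \<omega> $ i /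
        (renewal_position A x\<^sub>0 I n \<omega> $ 1 + renewal_position A x\<^sub>0 I n \<omega> $ 2)"
    and path: "AE \<omega> in M. \<forall>t\<ge>0. \<forall>n. renewal_time W n \<omega> \<le> t \<and> t < renewal_time W (Suc n) \<omega> \<longrightarrow>
        X t \<omega> = renewal_position A x\<^sub>0 I n \<omega>"
    by blast
  have total: "renewal_position A x\<^sub>0 I n \<omega> $ 1 + renewal_position A x\<^sub>0 I n \<omega> $ 2 =
      x\<^sub>0 $ 1 + x\<^sub>0 $ 2 + \<delta> * n" for n \<omega>
    by (simp add: pos)
  interpret prob_space M by (rule M)
  interpret triangular_renewals M W I "x\<^sub>0 $ 1" "x\<^sub>0 $ 2" \<alpha> \<delta>
  proof unfold_locales
    show "0 < x\<^sub>0 $ 1 + x\<^sub>0 $ 2" using assms(3-5) by linarith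
    show "AE \<omega> in M. real_cond_exp M (history M W I n) (indicator {\<omega> \<in> space M. r < W n \<omega>}) \<omega> =
        exp (- (x\<^sub>0 $ 1 + x\<^sub>0 $ 2 + \<delta> * n) * r)" if "0 \<le> r" for n r
      using wait[rule_format, OF that, of n] unfolding total .
    show "AE \<omega> in M. real_cond_exp M (history_wait M W I n) (indicator {\<omega> \<in> space M. I n \<omega> = 1}) \<omega> =
        (x\<^sub>0 $ 1 + \<alpha> * type_count I n \<omega>) / (x\<^sub>0 $ 1 + x\<^sub>0 $ 2 + \<delta> * n)" for n
      using type[rule_format, of n 1] unfolding total unfolding pos .
  qed (use W I assms \<delta> in auto)
  have Xt: "X t \<in> borel_measurable M" using X t by simp
  have [measurable]: "(\<lambda>\<omega>. X t \<omega> $ i) \<in> borel_measurable M" for i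
    by (rule measurable_compose[OF Xt]) (intro borel_measurable_continuous_onI continuous_intros)
  have Z: "AE \<omega> in M. \<forall>n. renewal_time W n \<omega> \<le> t \<and> t < renewal_time W (Suc n) \<omega> \<longrightarrow>
      X t \<omega> $ 1 = x\<^sub>0 $ 1 + \<alpha> * type_count I n \<omega> \<and> X t \<omega> $ 2 = x\<^sub>0 $ 2 + \<delta> * n - \<alpha> * type_count I n \<omega>"
    using path by (rule eventually_mono) (use t pos in auto)
  show "\<forall>\<^sub>F (u, v) in nhds (0, 0).
           integrable M (\<lambda>\<omega>. exp (u * X t \<omega> $ 1 + v * X t \<omega> $ 2)) \<and>
           (LINT \<omega>|M. exp (u * X t \<omega> $ 1 + v * X t \<omega> $ 2)) =
             exp (- (x\<^sub>0 $ 1) * t) *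
             (exp (- \<alpha> * u) - exp (- \<alpha> * v)
               + (exp (- \<delta> * v) - 1 + exp (- \<delta> * t)) powr (\<alpha> / \<delta>)) powr (- (x\<^sub>0 $ 1) / \<alpha>) *
             (exp (- (x\<^sub>0 $ 2) * t) *
              (exp (- \<delta> * v) - 1 + exp (- \<delta> * t)) powr (- (x\<^sub>0 $ 2) / \<delta>))"
    using eventually_mgf_domain[OF assms(1) \<delta> t]
  proof (rule eventually_mono, clarify)
    fix u v :: real
    assume "(1 - exp (- \<delta> * t)) * exp (\<delta> * snd (u, v)) < 1"
      and "exp (\<alpha> * (fst (u, v) - snd (u, v))) *
        (1 - (1 - (1 - exp (- \<delta> * t)) * exp (\<delta> * snd (u, v))) powr (\<alpha> / \<delta>)) < 1"
    note mgf = nn_integral_mgf[OF t Z this[simplified fst_conv snd_conv]]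
    show "integrable M (\<lambda>\<omega>. exp (u * X t \<omega> $ 1 + v * X t \<omega> $ 2)) \<and>
           (LINT \<omega>|M. exp (u * X t \<omega> $ 1 + v * X t \<omega> $ 2)) =
             exp (- (x\<^sub>0 $ 1) * t) *
             (exp (- \<alpha> * u) - exp (- \<alpha> * v)
               + (exp (- \<delta> * v) - 1 + exp (- \<delta> * t)) powr (\<alpha> / \<delta>)) powr (- (x\<^sub>0 $ 1) / \<alpha>) *
             (exp (- (x\<^sub>0 $ 2) * t) *
              (exp (- \<delta> * v) - 1 + exp (- \<delta> * t)) powr (- (x\<^sub>0 $ 2) / \<delta>))"
      by (rule nn_integral_eq_integrable[THEN iffD1, OF _ _ _ mgf]) auto
  qed
qed

end
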